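(* Assume the setting in the context with $d\ge2$. There exist absolute constants $C_1,C_2>0$ such that the following holds. Set $\lambda=C_1\sqrt{M\log d/n}$ and $\tau=(C_2Mn/\log d)^{1/4}$. Let $\hat W$ be any maximizer of $$\langle W,\bar\Sigma\rangle-\lambda\|W\|_1\quad\text{subject to}\quad0\preceq W\preceq I_d,\ \mathrm{trace}(W)=k,$$ and let $\hat V\in\mathbb{R}^{d\times k}$ have as columns orthonormal eigenvectors of $\hat W$ for its $k$ largest eigenvalues. Then with probability at least $1-d^{-2}$, $$\inf_{O\in\mathbb{O}_k}\|\hat V-V^*O\|_F\le\frac{4\sqrt2}{\rho_0}\,s^*\lambda,$$ where $\mathbb{O}_k$ is the set of $k\times k$ orthogonal matrices.
   Context: $X\in\mathbb{R}^d$ is a random vector with $\mathbb{E}X=0$ and covariance $\Sigma=\mathbb{E}[XX^\top]$ with eigenvalues $\lambda_1(\Sigma)\ge\dots\ge\lambda_d(\Sigma)$; $\rho_0=\lambda_k(\Sigma)-\lambda_{k+1}(\Sigma)>0$. $V^*\in\mathbb{R}^{d\times k}$ has as orthonormal columns top-$k$ eigenvectors of $\Sigma$, and $V^*$ has at most $s^*$ nonzero rows. Moments: $\mathbb{E}|X_j|^4\le M$ and $\mathbb{E}|X_jX_l|^2\le M$ for all $j,l\in[d]$. Data: $X_1,\dots,X_n$ i.i.d. copies of $X$. Truncation: for $v\in\mathbb{R}^d$, $\vartheta(v)$ has entries $\vartheta_j(v)=\mathrm{sign}(v_j)\min\{|v_j|,\tau\}$; $\bar X_i=\vartheta(X_i)$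 and $\bar\Sigma=\frac1n\sum_{i=1}^n\bar X_i\bar X_i^\top$. $\|W\|_1=\sum_{j,l}|W_{jl}|$; $\preceq$ is the Loewner order; $\langle A,B\rangle=\mathrm{trace}(A^\top B)$. *)

theory Defs
  imports "HOL-Probability.Probability" "Jordan_Normal_Form.Char_Poly"
begin

definition mtrace :: "real mat \<Rightarrow> real" where
  "mtrace A = (\<Sum>i<dim_row A. A $$ (i, i))"

definition frob_inner :: "real mat \<Rightarrow> real mat \<Rightarrow> real" where
  "frob_inner A B = mtrace (transpose_mat A * B)"

definition frob_norm :: "real mat \<Rightarrow> real" where
  "frob_norm A = sqrt (\<Sum>i<dim_row A. \<Sum>j<dim_col A. (A $$ (i, j))\<^sup>2)"

definition entry_l1 :: "real mat \<Rightarrow> real" where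
  "entry_l1 A = (\<Sum>i<dim_row A. \<Sum>j<dim_col A. \<bar>A $$ (i, j)\<bar>)"

definition psd :: "nat \<Rightarrow> real mat \<Rightarrow> bool" where
  "psd d A \<longleftrightarrow> A \<in> carrier_mat d d \<and> transpose_mat A = A \<and>
     (\<forall>v \<in> carrier_vec d. 0 \<le> v \<bullet> (A *\<^sub>v v))"

definition loewner_le :: "nat \<Rightarrow> real mat \<Rightarrow> real mat \<Rightarrow> bool" where
  "loewner_le d A B \<longleftrightarrow> A \<in> carrier_mat d d \<and> B \<in> carrier_mat d d \<and> psd d (B - A)"

(* eigenvalues with multiplicity (roots of the characteristic polynomial), in decreasing order;
   eig A i is the i-th largest, 1-indexed *)
definition eigvals_desc :: "real mat \<Rightarrow> real list" where
  "eigvals_desc A = rev (sorted_list_of_multiset (proots (char_poly A)))"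

definition eig :: "real mat \<Rightarrow> nat \<Rightarrow> real" where
  "eig A i = eigvals_desc A ! (i - 1)"

definition top_eigvecs :: "nat \<Rightarrow> nat \<Rightarrow> real mat \<Rightarrow> real mat \<Rightarrow> bool" where
  "top_eigvecs d k A V \<longleftrightarrow> V \<in> carrier_mat d k \<and> transpose_mat V * V = 1\<^sub>m k \<and>
     (\<forall>j<k. A *\<^sub>v col V j = eig A (Suc j) \<cdot>\<^sub>v col V j)"

definition orth_mats :: "nat \<Rightarrow> real mat set" where
  "orth_mats k = {Q \<in> carrier_mat k k. transpose_mat Q * Q = 1\<^sub>m k}"

definition nonzero_rows :: "real mat \<Rightarrow> nat" where
  "nonzero_rows V = card {j. j < dim_row V \<and> (\<exists>c<dim_col V. V $$ (j, c) \<noteq> 0)}"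

definition trunc :: "real \<Rightarrow> (nat \<Rightarrow> real) \<Rightarrow> (nat \<Rightarrow> real)" where
  "trunc \<tau> v = (\<lambda>j. sgn (v j) * min \<bar>v j\<bar> \<tau>)"

(* population covariance of a distribution \<mu> on R^d (points are functions on {..<d}) *)
definition cov_mat :: "nat \<Rightarrow> (nat \<Rightarrow> real) measure \<Rightarrow> real mat" where
  "cov_mat d \<mu> = mat d d (\<lambda>(j, l). \<integral>x. x j * x l \<partial>\<mu>)"

definition trunc_sample_cov :: "nat \<Rightarrow> nat \<Rightarrow> real \<Rightarrow> (nat \<Rightarrow> nat \<Rightarrow> real) \<Rightarrow> real mat" where
  "trunc_sample_cov d n \<tau> \<omega> =
     mat d d (\<lambda>(j, l). (1 / real n) * (\<Sum>i<n. trunc \<tau> (\<omega> i) j * trunc \<tau> (\<omega> i) l))"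

definition fantope :: "nat \<Rightarrow> nat \<Rightarrow> real mat set" where
  "fantope d k = {W. loewner_le d (0\<^sub>m d d) W \<and> loewner_le d W (1\<^sub>m d) \<and> mtrace W = real k}"

definition is_maximizer :: "nat \<Rightarrow> nat \<Rightarrow> real \<Rightarrow> real mat \<Rightarrow> real mat \<Rightarrow> bool" where
  "is_maximizer d k lam S W \<longleftrightarrow> W \<in> fantope d k \<and>
     (\<forall>W' \<in> fantope d k. frob_inner W' S - lam * entry_l1 W' \<le> frob_inner W S - lam * entry_l1 W)"

end

(*
  Let R be the projector onto the span of the columns of Vstar and Delta = R - W. Comparing Sigma with
  the Fantope in an orthonormal eigenbasis of Sigma gives the curvature bound
  (rho0 / 2) |Delta|^2 <= <Sigma, Delta>. Since W beats R in the penalized problem, and R vanishes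
  off an s x s block, an entrywise noise level of lambda / 4 gives |Delta| <= (5/2) s lambda / rho0.
  The same curvature bound for W in place of Sigma shows that the projector V V^T is at least as close
  to W as R is, so |V V^T - R| <= 2 |Delta|; this dominates the aligned distance between the frames,
  and 5 <= 4 sqrt 2.
  Choosing C1 larger than the noise requires is what pays for this factor 2: with noise level
  lambda the same argument would only give the constant 8.
  The noise level comes from a Chernoff bound for the truncated products with parameter 1 / tau^2
  (each entry deviates by at most 6 eps with probability 1 - 2 d^(-5), eps = sqrt (M log d / n)), and
  a truncation bias of at most 2 M / tau^2 = 2 eps. Hence C1 = 32 and C2 = 1.
*)
theory Submission
  imports Defs
begin

no_notation vec_nth (infixl "$" 90) and inner (infix "\<bullet>" 70)


section \<open>Orthonormal families\<close>

text \<open>Eigenvalues enter as sorted roots of the characteristic polynomial, while the estimates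
  need orthonormal eigenbases that begin with a prescribed frame. So the spectral theorem is proved
  as an extension result for orthonormal eigenvectors, and cancelling the prescribed roots from the
  multiset of all roots controls the remaining ones. The curvature bound is a transport argument:
  the diagonal of W in an eigenbasis of Sigma has entries in [0, 1] and sum k, so the mass missing
  on the top k directions sits on the lower ones, and each unit of it costs at least the gap. For W
  itself the gap may be 0, so there the bound supplies only a sign. Frames and projectors are
  compared through the singular values sigma of V^T U: the squared distances are 2 (k - sum sigma)
  for the polar rotation and 2 (k - sum sigma^2), and sigma is at most 1. No measurable choice of a
  maximizer is made. The event only says that every entry of the truncated covariance is accurate;
  what follows on it is deterministic and covers all maximizers and all their top eigenvectors at
  once.\<close>

definition orthonormal :: "nat \<Rightarrow> nat \<Rightarrow> (nat \<Rightarrow> real vec) \<Rightarrow> bool" where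
  "orthonormal d m q \<longleftrightarrow> (\<forall>i<m. q i \<in> carrier_vec d) \<and>
     (\<forall>i<m. \<forall>j<m. q i \<bullet> q j = (if i = j then 1 else 0))"

definition mat_of_family :: "nat \<Rightarrow> (nat \<Rightarrow> real vec) \<Rightarrow> real mat" where
  "mat_of_family d q = mat d d (\<lambda>(r, c). q c $ r)"

lemma mat_of_family_carrier [simp]: "mat_of_family d q \<in> carrier_mat d d"
  by (simp add: mat_of_family_def)

lemma dim_mat_of_family [simp]:
  "dim_row (mat_of_family d q) = d" "dim_col (mat_of_family d q) = d"
  by (simp_all add: mat_of_family_def)

lemma col_mat_of_family: "orthonormal d d q \<Longrightarrow> j < d \<Longrightarrow> col (mat_of_family d q) j = q j"
  by (intro eq_vecI) (auto simp: mat_of_family_def orthonormal_def)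

lemma mat_of_family_orthogonal:
  assumes q: "orthonormal d d q"
  shows "transpose_mat (mat_of_family d q) * mat_of_family d q = 1\<^sub>m d"
    and "mat_of_family d q * transpose_mat (mat_of_family d q) = 1\<^sub>m d"
proof -
  let ?Q = "mat_of_family d q"
  have Q: "?Q \<in> carrier_mat d d" by simp
  show "transpose_mat ?Q * ?Q = 1\<^sub>m d"
    using q by (intro eq_matI) (auto simp: col_mat_of_family[OF q] orthonormal_def)
  then show "?Q * transpose_mat ?Q = 1\<^sub>m d"
    using Q mat_mult_left_right_inverse[of "transpose_mat ?Q" d ?Q] by simp
qed

text \<open>This is Q Q^T = 1 read entrywise. The basis change identities \<open>parseval\<close>
  and \<open>mtrace_orthonormal\<close> reduce to it after expanding in coordinates.\<close>

lemma orthonormal_completeness: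
  assumes q: "orthonormal d d q" and a: "a < d" and b: "b < d"
  shows "(\<Sum>i<d. q i $ a * q i $ b) = (if a = b then 1 else (0::real))"
  using arg_cong[OF mat_of_family_orthogonal(2)[OF q], of "\<lambda>M. M $$ (a, b)"] a b
  by (simp add: scalar_prod_def mat_of_family_def lessThan_atLeast0)

lemma scalar_prod_sum:
  "x \<in> carrier_vec d \<Longrightarrow> y \<in> carrier_vec d \<Longrightarrow> x \<bullet> y = (\<Sum>a<d. x $ a * y $ a)"
  by (simp add: scalar_prod_def lessThan_atLeast0)

lemma mult_mat_vec_sum:
  "M \<in> carrier_mat n d \<Longrightarrow> x \<in> carrier_vec d \<Longrightarrow> a < n \<Longrightarrow> (M *\<^sub>v x) $ a = (\<Sum>b<d. M $$ (a, b) * x $ b)"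
  by (auto simp: scalar_prod_def lessThan_atLeast0)

lemma sum_swap_triple:
  fixes f :: "'i \<Rightarrow> 'a \<Rightarrow> 'b \<Rightarrow> 'c :: comm_monoid_add"
  shows "(\<Sum>i\<in>I. \<Sum>a\<in>A. \<Sum>b\<in>B. f i a b) = (\<Sum>a\<in>A. \<Sum>b\<in>B. \<Sum>i\<in>I. f i a b)"
  by (subst sum.swap, rule sum.cong[OF refl], rule sum.swap)

lemma parseval:
  assumes q: "orthonormal d d q" and x: "x \<in> carrier_vec d" and y: "y \<in> carrier_vec d"
  shows "(\<Sum>i<d. (q i \<bullet> x) * (q i \<bullet> y)) = x \<bullet> (y :: real vec)"
proof -
  have "(\<Sum>i<d. (q i \<bullet> x) * (q i \<bullet> y)) = (\<Sum>i<d. \<Sum>a<d. \<Sum>b<d. (q i $ a * q i $ b) * (x $ a * y $ b))"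
  proof (intro sum.cong refl)
    fix i assume "i \<in> {..<d}"
    then have qi: "q i \<in> carrier_vec d" using q by (simp add: orthonormal_def)
    show "(q i \<bullet> x) * (q i \<bullet> y) = (\<Sum>a<d. \<Sum>b<d. (q i $ a * q i $ b) * (x $ a * y $ b))"
      unfolding scalar_prod_sum[OF qi x] scalar_prod_sum[OF qi y]
      by (simp add: sum_product algebra_simps)
  qed
  also have "\<dots> = (\<Sum>a<d. \<Sum>b<d. (\<Sum>i<d. q i $ a * q i $ b) * (x $ a * y $ b))"
    unfolding sum_distrib_right by (rule sum_swap_triple)
  also have "\<dots> = (\<Sum>a<d. \<Sum>b<d. if a = b then x $ a * y $ b else 0)"
    by (intro sum.cong refl) (simp add: orthonormal_completeness[OF q])
  also have "\<dots> = x \<bullet> y" using x y by (simp add: scalar_prod_sum)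
  finally show ?thesis .
qed

lemma quadratic_form_sum:
  assumes M: "M \<in> carrier_mat d d" and x: "x \<in> carrier_vec d"
  shows "x \<bullet> (M *\<^sub>v x) = (\<Sum>a<d. \<Sum>b<d. (x $ a * x $ b) * (M $$ (a, b) :: real))"
proof -
  have "x \<bullet> (M *\<^sub>v x) = (\<Sum>a<d. x $ a * (M *\<^sub>v x) $ a)"
    using M x by (intro scalar_prod_sum) auto
  also have "\<dots> = (\<Sum>a<d. \<Sum>b<d. (x $ a * x $ b) * M $$ (a, b))"
    by (intro sum.cong refl, subst mult_mat_vec_sum[OF M x])
       (auto simp: sum_distrib_left algebra_simps intro!: sum.cong)
  finally show ?thesis .
qed

lemma mtrace_orthonormal:
  assumes q: "orthonormal d d q" and M: "M \<in> carrier_mat d d"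
  shows "mtrace M = (\<Sum>i<d. q i \<bullet> (M *\<^sub>v q i))"
proof -
  have "(\<Sum>i<d. q i \<bullet> (M *\<^sub>v q i)) = (\<Sum>i<d. \<Sum>a<d. \<Sum>b<d. (q i $ a * q i $ b) * M $$ (a, b))"
    using q by (intro sum.cong refl quadratic_form_sum[OF M]) (simp add: orthonormal_def)
  also have "\<dots> = (\<Sum>a<d. \<Sum>b<d. (\<Sum>i<d. q i $ a * q i $ b) * M $$ (a, b))"
    unfolding sum_distrib_right by (rule sum_swap_triple)
  also have "\<dots> = (\<Sum>a<d. \<Sum>b<d. if a = b then M $$ (a, b) else 0)"
    by (intro sum.cong refl) (simp add: orthonormal_completeness[OF q])
  also have "\<dots> = mtrace M" using M by (simp add: mtrace_def)
  finally show ?thesis by simp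
qed

lemma scalar_prod_self_pos:
  assumes "x \<in> carrier_vec d" "x \<noteq> 0\<^sub>v d" shows "x \<bullet> (x :: real vec) > 0"
proof -
  from assms obtain a where "a < d" "x $ a \<noteq> 0" by (metis carrier_vecD eq_vecI index_zero_vec)
  then have "0 < (\<Sum>a<d. x $ a * x $ a)" by (intro sum_pos2[where i = a]) (auto simp: zero_less_mult_iff)
  then show ?thesis using assms by (simp add: scalar_prod_sum)
qed

section \<open>Unit vectors in orthogonal complements\<close>

text \<open>The square matrix with rows \<open>p i\<close> has a zero row, hence a nontrivial
  kernel, and a kernel vector is orthogonal to all rows. Allowing the zero slot at any position
  \<open>m\<close> serves both the extension of k vectors (pad with zeros) and the filling of gaps
  in a partial family.\<close>

lemma exists_unit_orthogonal_of_zero: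
  assumes p: "\<And>i. i < d \<Longrightarrow> p i \<in> carrier_vec d" and m: "m < d" "p m = 0\<^sub>v d"
  shows "\<exists>x \<in> carrier_vec d. x \<bullet> x = (1::real) \<and> (\<forall>i<d. p i \<bullet> x = 0)"
proof -
  define A where "A = mat d d (\<lambda>(r, c). p r $ c)"
  have A: "A \<in> carrier_mat d d" by (simp add: A_def)
  have rowA: "row A i = p i" if "i < d" for i
    using p[OF that] that by (intro eq_vecI) (auto simp: A_def)
  have "transpose_mat A *\<^sub>v unit_vec d m = 0\<^sub>v d"
    using A m rowA[OF m(1)] by (intro eq_vecI) (auto simp: A_def)
  moreover have "unit_vec d m \<noteq> (0\<^sub>v d :: real vec)" using m(1) by simp
  ultimately have "det (transpose_mat A) = 0"
    using det_0_iff_vec_prod_zero[of "transpose_mat A" d] A by (metis transpose_carrier_mat unit_vec_carrier)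
  then have "det A = 0" using det_transpose[OF A] by simp
  then obtain y where y: "y \<in> carrier_vec d" "y \<noteq> 0\<^sub>v d" "A *\<^sub>v y = 0\<^sub>v d"
    using det_0_iff_vec_prod_zero[OF A] by blast
  have py: "p i \<bullet> y = 0" if "i < d" for i
    using arg_cong[OF y(3), of "\<lambda>v. v $ i"] that A by (simp add: rowA)
  have yy: "y \<bullet> y > 0" using scalar_prod_self_pos[OF y(1,2)] .
  define x where "x = (1 / sqrt (y \<bullet> y)) \<cdot>\<^sub>v y"
  have "x \<bullet> x = 1" using y(1) yy by (simp add: x_def field_simps)
  moreover have "p i \<bullet> x = 0" if "i < d" for i
    using py[OF that] p[OF that] y(1) by (simp add: x_def)
  moreover have "x \<in> carrier_vec d" using y(1) by (simp add: x_def)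
  ultimately show ?thesis by blast
qed

lemma exists_unit_orthogonal:
  assumes p: "\<And>i. i < k \<Longrightarrow> p i \<in> carrier_vec d" and k: "k < d"
  shows "\<exists>x \<in> carrier_vec d. x \<bullet> x = (1::real) \<and> (\<forall>i<k. p i \<bullet> x = 0)"
proof -
  define p' where "p' i = (if i < k then p i else 0\<^sub>v d)" for i
  have "\<exists>x \<in> carrier_vec d. x \<bullet> x = 1 \<and> (\<forall>i<d. p' i \<bullet> x = 0)"
    by (rule exists_unit_orthogonal_of_zero[of _ _ k]) (use p k in \<open>auto simp: p'_def\<close>)
  then obtain x where x: "x \<in> carrier_vec d" "x \<bullet> x = 1" "\<And>i. i < d \<Longrightarrow> p' i \<bullet> x = 0" by blast
  have "p i \<bullet> x = 0" if "i < k" for i using x(3)[of i] that k by (simp add: p'_def)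
  with x show ?thesis by blast
qed

section \<open>Spectral theorem for real symmetric matrices\<close>

text \<open>Compactness is taken in the product topology on \<open>nat => real\<close>, with the
  coordinates from \<open>d\<close> on pinned to 0, so that the dimension can remain a variable. The
  compactness itself is Tychonoff's theorem.\<close>

lemma compact_unit_cube: "compact {f :: nat \<Rightarrow> real. \<forall>i. f i \<in> (if i < d then {-1..1} else {0})}"
proof -
  have "compactin (product_topology (\<lambda>i. euclidean) UNIV) (PiE UNIV (\<lambda>i. if i < d then {-1..1} else {0::real}))"
    by (subst compactin_PiE) auto
  moreover have "PiE UNIV (\<lambda>i. if i < d then {-1..1} else {0::real}) =
      {f. \<forall>i. f i \<in> (if i < d then {-1..1} else {0})}"
    by (auto simp: PiE_def Pi_def)
  ultimately show ?thesis by (simp add: euclidean_product_topology)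
qed

text \<open>The unit vectors orthogonal to all \<open>p i\<close> form a closed subset of the cube,
  nonempty because k < d, and the quadratic form is continuous there.\<close>

lemma exists_rayleigh_maximizer:
  assumes A: "A \<in> carrier_mat d d" and p: "\<And>i. i < k \<Longrightarrow> p i \<in> carrier_vec d" and k: "k < d"
  shows "\<exists>x \<in> carrier_vec d. x \<bullet> x = (1::real) \<and> (\<forall>i<k. p i \<bullet> x = 0) \<and>
    (\<forall>y \<in> carrier_vec d. y \<bullet> y = 1 \<longrightarrow> (\<forall>i<k. p i \<bullet> y = 0) \<longrightarrow> y \<bullet> (A *\<^sub>v y) \<le> x \<bullet> (A *\<^sub>v x))"
proof -
  define C where "C = {f :: nat \<Rightarrow> real. \<forall>i. f i \<in> (if i < d then {-1..1} else {0})}"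
  define K where "K = C \<inter> {f. (\<Sum>a<d. f a * f a) = 1} \<inter> (\<Inter>i\<in>{..<k}. {f. (\<Sum>a<d. p i $ a * f a) = 0})"
  define g where "g f = (\<Sum>a<d. f a * (\<Sum>b<d. A $$ (a, b) * f b))" for f :: "nat \<Rightarrow> real"
  have cont: "continuous_on S (\<lambda>f. f a)" for S and a :: nat and f :: "nat \<Rightarrow> real"
    by (rule continuous_on_subset[OF continuous_on_product_coordinates]) simp
  have cK: "compact K"
    unfolding K_def C_def
    by (intro compact_Int_closed compact_unit_cube closed_INT ballI closed_Collect_eq continuous_intros cont)
  \<comment> \<open>Translates a feasible vector into a point of \<open>K\<close>. Its coordinates
    lie in [-1, 1] because each square is at most the sum of all squares, which is 1.\<close>
  have rep: "(\<lambda>a. if a < d then y $ a else 0) \<in> K"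
    if y: "y \<in> carrier_vec d" "y \<bullet> y = 1" "\<And>i. i < k \<Longrightarrow> p i \<bullet> y = 0" for y :: "real vec"
  proof -
    have s: "(\<Sum>a<d. y $ a * y $ a) = 1" using y by (simp add: scalar_prod_sum)
    have "- 1 \<le> y $ a \<and> y $ a \<le> 1" if "a < d" for a
    proof -
      have "y $ a * y $ a \<le> (\<Sum>a<d. y $ a * y $ a)"
        by (rule member_le_sum) (use that in auto)
      then have "(y $ a)\<^sup>2 \<le> 1" using s by (simp add: power2_eq_square)
      then have "\<bar>y $ a\<bar> \<le> 1" by (simp add: abs_square_le_1)
      then show ?thesis by linarith
    qed
    moreover have "(\<Sum>a<d. p i $ a * y $ a) = 0" if "i < k" for i
      using y(3)[OF that] p[OF that] y(1) by (simp add: scalar_prod_sum)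
    moreover have "(\<Sum>a<d. h a * (if a < d then y $ a else 0)) = (\<Sum>a<d. h a * y $ a)" for h
      by (intro sum.cong) auto
    moreover have "(\<Sum>a<d. (if a < d then y $ a else 0) * (if a < d then y $ a else 0)) = (\<Sum>a<d. y $ a * y $ a)"
      by (intro sum.cong) auto
    ultimately show ?thesis using s by (simp add: K_def C_def)
  qed
  have gval: "g (\<lambda>a. if a < d then y $ a else 0) = y \<bullet> (A *\<^sub>v y)" if y: "y \<in> carrier_vec d" for y
  proof -
    have "y \<bullet> (A *\<^sub>v y) = (\<Sum>a<d. y $ a * (A *\<^sub>v y) $ a)"
      using A y by (intro scalar_prod_sum) auto
    also have "\<dots> = g (\<lambda>a. if a < d then y $ a else 0)"
      unfolding g_def by (intro sum.cong refl, subst mult_mat_vec_sum[OF A y]) auto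
    finally show ?thesis by simp
  qed
  have neK: "K \<noteq> {}"
    using exists_unit_orthogonal[of k p d, OF p k] rep by blast
  have "continuous_on K g"
    unfolding g_def by (intro continuous_intros cont)
  from continuous_attains_sup[OF cK neK this]
  obtain f where f: "f \<in> K" "\<And>h. h \<in> K \<Longrightarrow> g h \<le> g f" by blast
  define x where "x = vec d f"
  have x: "x \<in> carrier_vec d" by (simp add: x_def)
  have f0: "f a = 0" if "\<not> a < d" for a
    using f(1) that unfolding K_def C_def by (auto dest: spec[of _ a])
  have fx: "(\<lambda>a. if a < d then x $ a else 0) = f"
    using f0 by (auto simp: x_def fun_eq_iff)
  have "x \<bullet> x = 1" unfolding scalar_prod_sum[OF x x] using f(1) by (simp add: K_def x_def)
  moreover have "p i \<bullet> x = 0" if "i < k" for i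
    unfolding scalar_prod_sum[OF p[OF that] x] using f(1) that by (simp add: K_def x_def)
  moreover have "y \<bullet> (A *\<^sub>v y) \<le> x \<bullet> (A *\<^sub>v x)"
    if "y \<in> carrier_vec d" "y \<bullet> y = 1" "\<forall>i<k. p i \<bullet> y = 0" for y
    using f(2)[OF rep[OF that(1,2)]] that gval[OF that(1)] gval[OF x] fx by simp
  ultimately show ?thesis using x by blast
qed

lemma symmetric_mat_scalar_prod:
  assumes A: "A \<in> carrier_mat d d" "transpose_mat A = A" and x: "x \<in> carrier_vec d" and y: "y \<in> carrier_vec d"
  shows "x \<bullet> (A *\<^sub>v y) = (A *\<^sub>v x) \<bullet> (y :: real vec)"
  using transpose_vec_mult_scalar[OF A(1) y x] A(2) by simp

lemma linear_coeff_zero: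
  assumes "\<And>t. (a::real) * t + b * t\<^sup>2 \<ge> 0" shows "a = 0"
proof (rule ccontr)
  assume a: "a \<noteq> 0"
  \<comment> \<open>Any positive \<open>s\<close> above \<open>b\<close> works: at t = - a / s the
    expression equals (a / s)^2 (b - s), which is negative unless a = 0.\<close>
  define s where "s = \<bar>b\<bar> + 1"
  have s: "s > 0" "b < s" by (auto simp: s_def)
  define t where "t = - a / s"
  have "a * t + b * t\<^sup>2 = (a\<^sup>2 / s\<^sup>2) * (b - s)"
    using s(1) by (simp add: t_def field_simps power2_eq_square)
  also have "\<dots> < 0" using a s by (intro mult_pos_neg) auto
  finally show False using assms[of t] by simp
qed

text \<open>Maximize the quadratic form over the unit vectors orthogonal to the given eigenvectors.
  Symmetry makes that complement invariant under \<open>A\<close>, so the residual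
  \<open>A x - c x\<close> is an admissible direction, and stationarity along it forces the residual
  to vanish.\<close>

lemma exists_orthogonal_eigenvector:
  assumes A: "A \<in> carrier_mat d d" "transpose_mat A = A"
    and p: "\<And>i. i < k \<Longrightarrow> p i \<in> carrier_vec d" and k: "k < d"
    and ev: "\<And>i. i < k \<Longrightarrow> A *\<^sub>v p i = \<mu> i \<cdot>\<^sub>v p i"
  shows "\<exists>x \<in> carrier_vec d. \<exists>c. x \<bullet> x = (1::real) \<and> (\<forall>i<k. p i \<bullet> x = 0) \<and> A *\<^sub>v x = c \<cdot>\<^sub>v x"
proof -
  obtain x where x: "x \<in> carrier_vec d" "x \<bullet> x = 1" and ox: "\<And>i. i < k \<Longrightarrow> p i \<bullet> x = 0"
    and mx: "\<And>y. y \<in> carrier_vec d \<Longrightarrow> y \<bullet> y = 1 \<Longrightarrow> \<forall>i<k. p i \<bullet> y = 0 \<Longrightarrow> y \<bullet> (A *\<^sub>v y) \<le> x \<bullet> (A *\<^sub>v x)"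
    using exists_rayleigh_maximizer[of A d k p, OF A(1) p k] by blast
  define c where "c = x \<bullet> (A *\<^sub>v x)"
  have Ac: "A *\<^sub>v y \<in> carrier_vec d" if "y \<in> carrier_vec d" for y using A(1) that by simp
  \<comment> \<open>The homogeneous form of maximality, so that the perturbed vector below need not
    be normalized.\<close>
  have ray: "y \<bullet> (A *\<^sub>v y) \<le> c * (y \<bullet> y)"
    if y: "y \<in> carrier_vec d" "\<And>i. i < k \<Longrightarrow> p i \<bullet> y = 0" for y
  proof (cases "y = 0\<^sub>v d")
    case True then show ?thesis using A(1) by simp
  next
    case False
    then have yy: "y \<bullet> y > 0" using scalar_prod_self_pos y(1) by blast
    define r where "r = 1 / sqrt (y \<bullet> y)"
    have r: "r * r * (y \<bullet> y) = 1" using yy by (simp add: r_def)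
    have Ay: "A *\<^sub>v (r \<cdot>\<^sub>v y) = r \<cdot>\<^sub>v (A *\<^sub>v y)" using A(1) y(1) by (rule mult_mat_vec)
    have "(r \<cdot>\<^sub>v y) \<bullet> (A *\<^sub>v (r \<cdot>\<^sub>v y)) \<le> c" unfolding c_def
    proof (rule mx)
      show "(r \<cdot>\<^sub>v y) \<bullet> (r \<cdot>\<^sub>v y) = 1" using y(1) r by (simp add: mult.assoc)
      show "\<forall>i<k. p i \<bullet> (r \<cdot>\<^sub>v y) = 0" using y p by simp
    qed (use y(1) in simp)
    then have "r * r * (y \<bullet> (A *\<^sub>v y)) \<le> c"
      using y(1) Ac[OF y(1)] by (simp add: Ay mult.assoc)
    then have "(r * r * (y \<bullet> (A *\<^sub>v y))) * (y \<bullet> y) \<le> c * (y \<bullet> y)"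
      using yy by (intro mult_right_mono) auto
    moreover have "(r * r * (y \<bullet> (A *\<^sub>v y))) * (y \<bullet> y) = (r * r * (y \<bullet> y)) * (y \<bullet> (A *\<^sub>v y))"
      by (simp only: mult_ac)
    ultimately show ?thesis using r by simp
  qed
  define y where "y = A *\<^sub>v x - c \<cdot>\<^sub>v x"
  have y: "y \<in> carrier_vec d" using x A(1) by (simp add: y_def)
  have oy: "p i \<bullet> y = 0" if i: "i < k" for i
  proof -
    have "p i \<bullet> (A *\<^sub>v x) = 0"
      using symmetric_mat_scalar_prod[OF A p[OF i] x(1)] ev[OF i] ox[OF i] p[OF i] x(1) by simp
    then show ?thesis unfolding y_def
      using p[OF i] x(1) ox[OF i] Ac[OF x(1)] by (simp add: scalar_prod_minus_distrib)
  qed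
  \<comment> \<open>First-order optimality of \<open>x\<close> along the direction \<open>y\<close>, which stays in the orthogonal complement.\<close>
  have "2 * (c * (x \<bullet> y) - y \<bullet> (A *\<^sub>v x)) = 0"
  proof (rule linear_coeff_zero)
    fix t
    let ?z = "x + t \<cdot>\<^sub>v y"
    have z: "?z \<in> carrier_vec d" using x y by simp
    have "?z \<bullet> (A *\<^sub>v ?z) \<le> c * (?z \<bullet> ?z)"
      by (rule ray[OF z]) (use x y p ox oy in \<open>simp add: scalar_prod_add_distrib[of _ d]\<close>)
    moreover have "A *\<^sub>v ?z = A *\<^sub>v x + t \<cdot>\<^sub>v (A *\<^sub>v y)"
      using x y A(1) by (simp add: mult_add_distrib_mat_vec mult_mat_vec)
    moreover have "x \<bullet> (A *\<^sub>v y) = y \<bullet> (A *\<^sub>v x)"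
      using symmetric_mat_scalar_prod[OF A x(1) y] comm_scalar_prod[OF Ac[OF x(1)] y] by simp
    moreover have "y \<bullet> x = x \<bullet> y" using comm_scalar_prod x(1) y by blast
    ultimately show "2 * (c * (x \<bullet> y) - y \<bullet> (A *\<^sub>v x)) * t + (c * (y \<bullet> y) - y \<bullet> (A *\<^sub>v y)) * t\<^sup>2 \<ge> 0"
      using x y Ac[OF x(1)] Ac[OF y] c_def
      by (simp add: scalar_prod_add_distrib[of _ d] add_scalar_prod_distrib[of _ d] algebra_simps power2_eq_square)
  qed
  \<comment> \<open>The squared norm of the residual is minus half the linear coefficient just shown
    to vanish.\<close>
  moreover have "y \<bullet> y = y \<bullet> (A *\<^sub>v x) - c * (x \<bullet> y)"
    using x(1) y Ac[OF x(1)] comm_scalar_prod[OF x(1) y]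
    by (subst (2) y_def) (simp add: scalar_prod_minus_distrib[of _ d])
  ultimately have "y \<bullet> y = 0" by simp
  then have "y = 0\<^sub>v d" using scalar_prod_self_pos[OF y] by fastforce
  then have "A *\<^sub>v x = c \<cdot>\<^sub>v x"
    unfolding y_def using x(1) A(1)
    by (intro eq_vecI) (auto simp: vec_eq_iff)
  with x ox show ?thesis by blast
qed

text \<open>Adds one eigenvector at a time, by induction on the number still missing. For k = 0 it
  is the spectral theorem; keeping the first k vectors and their eigenvalues is what later ties a
  given frame to a full eigenbasis.\<close>

lemma extend_to_eigenbasis:
  assumes A: "A \<in> carrier_mat d d" "transpose_mat A = A"
    and k: "k \<le> d" and p: "orthonormal d k p"
    and ev: "\<And>i. i < k \<Longrightarrow> A *\<^sub>v p i = \<mu> i \<cdot>\<^sub>v p i"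
  shows "\<exists>q \<nu>. orthonormal d d q \<and> (\<forall>i<d. A *\<^sub>v q i = \<nu> i \<cdot>\<^sub>v q i) \<and> (\<forall>i<k. q i = p i \<and> \<nu> i = \<mu> i)"
  using k p ev
proof (induction "d - k" arbitrary: k p \<mu>)
  case 0
  then have "k = d" by simp
  with 0 show ?case by (intro exI[of _ p] exI[of _ \<mu>]) simp
next
  case (Suc m)
  then have k: "k < d" by simp
  have p: "\<And>i. i < k \<Longrightarrow> p i \<in> carrier_vec d" using Suc.prems(2) by (simp add: orthonormal_def)
  obtain x c where x: "x \<in> carrier_vec d" "x \<bullet> x = 1" "\<And>i. i < k \<Longrightarrow> p i \<bullet> x = 0" "A *\<^sub>v x = c \<cdot>\<^sub>v x"
    using exists_orthogonal_eigenvector[of A d k p \<mu>, OF A p k Suc.prems(3)] by blast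
  have x': "x \<bullet> p i = 0" if "i < k" for i
    using x(3)[OF that] comm_scalar_prod[OF x(1) p[OF that]] by simp
  have "orthonormal d (Suc k) (p(k := x))"
    using Suc.prems(2) x x' by (auto simp: orthonormal_def less_Suc_eq)
  moreover have "A *\<^sub>v (p(k := x)) i = (\<mu>(k := c)) i \<cdot>\<^sub>v (p(k := x)) i" if "i < Suc k" for i
    using that x(4) Suc.prems(3) by (auto simp: less_Suc_eq)
  moreover have "m = d - Suc k" "Suc k \<le> d" using Suc.hyps(2) k by auto
  ultimately obtain q \<nu> where q: "orthonormal d d q" "\<forall>i<d. A *\<^sub>v q i = \<nu> i \<cdot>\<^sub>v q i"
      "\<forall>i<Suc k. q i = (p(k := x)) i \<and> \<nu> i = (\<mu>(k := c)) i"
    using Suc.hyps(1)[of "Suc k" "p(k := x)" "\<mu>(k := c)"] by metis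
  then show ?case by (intro exI[of _ q] exI[of _ \<nu>]) (auto simp: less_Suc_eq)
qed

text \<open>The bridge between \<open>eigvals_desc\<close> and eigenbases: \<open>A\<close> is
  similar to the diagonal matrix of the \<open>\<mu> i\<close>, and similar matrices share their
  characteristic polynomial, hence its roots with multiplicity.\<close>

lemma proots_char_poly_eigenbasis:
  assumes A: "A \<in> carrier_mat d d" and q: "orthonormal d d q"
    and ev: "\<And>i. i < d \<Longrightarrow> A *\<^sub>v q i = \<mu> i \<cdot>\<^sub>v q i"
  shows "proots (char_poly A) = mset (map \<mu> [0..<d])"
proof -
  define Q where "Q = mat_of_family d q"
  have Q: "Q \<in> carrier_mat d d" by (simp add: Q_def)
  note colQ = col_mat_of_family[OF q, folded Q_def] and QQ = mat_of_family_orthogonal[OF q, folded Q_def]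
  have "A * Q = Q * mat_diag d \<mu>"
  proof (rule mat_col_eqI)
    fix i assume "i < dim_col (Q * mat_diag d \<mu>)"
    then have i: "i < d" by (simp add: mat_diag_def)
    have "col (A * Q) i = \<mu> i \<cdot>\<^sub>v q i" using col_mult2[OF A Q i] i by (simp only: colQ ev)
    also have "\<dots> = col (Q * mat_diag d \<mu>) i"
      unfolding mat_diag_mult_right[OF Q]
      using q i by (intro eq_vecI) (auto simp: Q_def mat_of_family_def orthonormal_def)
    finally show "col (A * Q) i = col (Q * mat_diag d \<mu>) i" .
  qed (use A Q in \<open>auto simp: mat_diag_def\<close>)
  then have "A = Q * mat_diag d \<mu> * transpose_mat Q"
    using A Q QQ(2) by (metis assoc_mult_mat right_mult_one_mat transpose_carrier_mat)
  then have "similar_mat A (mat_diag d \<mu>)"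
    unfolding similar_mat_def similar_mat_wit_def using A Q QQ
    by (intro exI[of _ Q] exI[of _ "transpose_mat Q"]) (simp add: Let_def)
  then have "char_poly A = char_poly (mat_diag d \<mu>)" by (rule char_poly_similar)
  also have "\<dots> = (\<Prod>a \<leftarrow> diag_mat (mat_diag d \<mu>). [:- a, 1:])"
    by (rule char_poly_upper_triangular[of _ d]) (auto simp: mat_diag_def upper_triangular_def)
  also have "diag_mat (mat_diag d \<mu>) = map \<mu> [0..<d]"
    by (auto simp: diag_mat_def mat_diag_def)
  finally have cp: "char_poly A = (\<Prod>i \<leftarrow> [0..<d]. [:- \<mu> i, 1:])" by (simp add: o_def)
  have "proots (\<Prod>i \<leftarrow> xs. [:- \<mu> i, 1:]) = mset (map \<mu> xs)" for xs :: "nat list"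
  proof (induction xs)
    case (Cons a xs)
    have "(\<Prod>i \<leftarrow> xs. [:- \<mu> i, 1:]) \<noteq> 0" by (auto simp: prod_list_zero_iff)
    then show ?case using Cons proots_mult[of "[:- \<mu> a, 1:]" "\<Prod>i \<leftarrow> xs. [:- \<mu> i, 1:]"]
      by (simp del: mult_pCons_left)
  qed simp
  then show ?thesis unfolding cp .
qed

section \<open>Frobenius geometry and the Fantope\<close>

lemma orthonormal_cols:
  assumes "V \<in> carrier_mat d k" "transpose_mat V * V = 1\<^sub>m k"
  shows "orthonormal d k (col V)"
proof -
  have "col V i \<bullet> col V j = (if i = j then 1 else 0)" if "i < k" "j < k" for i j
    using arg_cong[OF assms(2), of "\<lambda>M. M $$ (i, j)"] assms(1) that by simp
  then show ?thesis using assms(1) by (auto simp: orthonormal_def)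
qed

section \<open>The sorted eigenvalue list and eigenbases\<close>

lemma eigvals_desc_antimono:
  "i \<le> j \<Longrightarrow> j < length (eigvals_desc A) \<Longrightarrow> eigvals_desc A ! j \<le> eigvals_desc A ! i"
  using sorted_rev_nth_mono[of "eigvals_desc A" i j] by (simp add: eigvals_desc_def)

lemma length_eigvals_desc:
  assumes A: "A \<in> carrier_mat d d" "transpose_mat A = A"
  shows "length (eigvals_desc A) = d"
proof -
  obtain q \<nu> where "orthonormal d d q" "\<forall>i<d. A *\<^sub>v q i = \<nu> i \<cdot>\<^sub>v q i"
    \<comment> \<open>The empty family is extended, so the starting data may be
      \<open>undefined\<close>.\<close>
    using extend_to_eigenbasis[OF A, of 0 undefined undefined] by (auto simp: orthonormal_def)
  then have "mset (eigvals_desc A) = mset (map \<nu> [0..<d])"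
    using proots_char_poly_eigenbasis[OF A(1)] by (simp add: eigvals_desc_def)
  then show ?thesis by (metis diff_zero length_map length_upt mset_eq_length)
qed

lemma eig_Suc_le:
  assumes A: "A \<in> carrier_mat d d" "transpose_mat A = A" and k: "1 \<le> k" "k < d"
  shows "eig A (k + 1) \<le> eig A k"
  using eigvals_desc_antimono[of "k - 1" k A] length_eigvals_desc[OF A] k by (simp add: eig_def)

text \<open>The extension lists the last d - k eigenvalues in no particular order. The first k agree
  with the head of the sorted list, so cancelling them in the multiset equality identifies the
  others with its tail, whose largest member is \<open>eig A (k + 1)\<close>.\<close>

lemma top_eigvecs_eigenbasis:
  assumes A: "A \<in> carrier_mat d d" "transpose_mat A = A"
    and V: "top_eigvecs d k A V" and k: "1 \<le> k" "k < d"
  shows "\<exists>q \<nu>. orthonormal d d q \<and> (\<forall>i<d. A *\<^sub>v q i = \<nu> i \<cdot>\<^sub>v q i) \<and> (\<forall>i<k. q i = col V i) \<and>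
    (\<forall>i<k. eig A k \<le> \<nu> i) \<and> (\<forall>i. k \<le> i \<longrightarrow> i < d \<longrightarrow> \<nu> i \<le> eig A (k + 1))"
proof -
  define l where "l = eigvals_desc A"
  have V': "V \<in> carrier_mat d k" "transpose_mat V * V = 1\<^sub>m k"
    and ev: "\<And>j. j < k \<Longrightarrow> A *\<^sub>v col V j = eig A (Suc j) \<cdot>\<^sub>v col V j"
    using V by (auto simp: top_eigvecs_def)
  obtain q \<nu> where q: "orthonormal d d q" "\<And>i. i < d \<Longrightarrow> A *\<^sub>v q i = \<nu> i \<cdot>\<^sub>v q i"
      and qk: "\<And>i. i < k \<Longrightarrow> q i = col V i \<and> \<nu> i = eig A (Suc i)"
    using extend_to_eigenbasis[OF A less_imp_le[OF k(2)] orthonormal_cols[OF V'], of "\<lambda>j. eig A (Suc j)"] ev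
    by blast
  have ml: "mset l = mset (map \<nu> [0..<d])"
    using proots_char_poly_eigenbasis[OF A(1) q] by (simp add: eigvals_desc_def l_def)
  have len: "length l = d" using length_eigvals_desc[OF A] by (simp add: l_def)
  have "take k l = map \<nu> [0..<k]"
    using k len qk by (intro nth_equalityI) (auto simp: eig_def l_def)
  moreover have "map \<nu> [0..<d] = map \<nu> [0..<k] @ map \<nu> [k..<d]"
    using k by (metis append_take_drop_id le_add_diff_inverse less_imp_le map_append upt_add_eq_append zero_le)
  ultimately have "mset (take k l) + mset (drop k l) = mset (take k l) + mset (map \<nu> [k..<d])"
    using ml by (metis append_take_drop_id mset_append)
  then have "mset (drop k l) = mset (map \<nu> [k..<d])" by simp
  then have rest: "set (drop k l) = \<nu> ` {k..<d}" by (metis list.set_map mset_eq_setD set_upt)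
  have "\<nu> i \<le> eig A (k + 1)" if i: "k \<le> i" "i < d" for i
  proof -
    have "\<nu> i \<in> set (drop k l)" using rest i by auto
    then obtain j where "j < length (drop k l)" "\<nu> i = drop k l ! j" by (metis in_set_conv_nth)
    then have "k + j < length l" "\<nu> i = l ! (k + j)" using len k by auto
    \<comment> \<open>\<open>eig\<close> counts from 1 and lists from 0, so position
      \<open>k\<close> of the list is \<open>eig A (k + 1)\<close>.\<close>
    then show ?thesis using eigvals_desc_antimono[of k "k + j" A] by (simp add: l_def eig_def)
  qed
  moreover have "eig A k \<le> \<nu> i" if "i < k" for i
    using that qk[OF that] eigvals_desc_antimono[of i "k - 1" A] len k by (simp add: l_def eig_def)
  ultimately show ?thesis using q qk by blast
qed

section \<open>The Frobenius inner product in coordinates and in an eigenbasis\<close>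

lemma frob_inner_sum:
  assumes "A \<in> carrier_mat n m" "B \<in> carrier_mat n m"
  shows "frob_inner A B = (\<Sum>a<n. \<Sum>b<m. A $$ (a, b) * B $$ (a, b))"
proof -
  have "frob_inner A B = (\<Sum>b<m. \<Sum>a<n. A $$ (a, b) * B $$ (a, b))"
    using assms by (simp add: frob_inner_def mtrace_def scalar_prod_def lessThan_atLeast0)
  then show ?thesis by (simp add: sum.swap[of _ "{..<m}"])
qed

lemma frob_norm_sq:
  assumes "A \<in> carrier_mat n m" shows "(frob_norm A)\<^sup>2 = frob_inner A A"
  unfolding frob_inner_sum[OF assms assms] using assms
  by (simp add: frob_norm_def power2_eq_square sum_nonneg)

lemma frob_norm_nonneg [simp]: "0 \<le> frob_norm A"
  by (simp add: frob_norm_def sum_nonneg)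

lemma frob_inner_comm:
  "A \<in> carrier_mat n m \<Longrightarrow> B \<in> carrier_mat n m \<Longrightarrow> frob_inner A B = frob_inner B A"
  by (simp add: frob_inner_sum mult.commute)

lemma frob_inner_diff_right:
  assumes "A \<in> carrier_mat n m" "B \<in> carrier_mat n m" "C \<in> carrier_mat n m"
  shows "frob_inner A (B - C) = frob_inner A B - frob_inner A C"
proof -
  have "B - C \<in> carrier_mat n m" using assms by (intro minus_carrier_mat)
  then show ?thesis using assms
    by (simp add: frob_inner_sum[of _ n m] algebra_simps sum_subtractf)
qed

lemma frob_norm_diff_sq:
  assumes "A \<in> carrier_mat n m" "B \<in> carrier_mat n m"
  shows "(frob_norm (A - B))\<^sup>2 = frob_inner A A - 2 * frob_inner A B + frob_inner B B"
proof -
  have AB: "A - B \<in> carrier_mat n m" using assms by (intro minus_carrier_mat)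
  have "(frob_norm (A - B))\<^sup>2 = frob_inner (A - B) A - frob_inner (A - B) B"
    using frob_norm_sq[OF AB] frob_inner_diff_right[OF AB assms] by simp
  also have "\<dots> = frob_inner A A - 2 * frob_inner A B + frob_inner B B"
    using frob_inner_comm[OF AB assms(1)] frob_inner_comm[OF AB assms(2)] frob_inner_comm[OF assms]
      frob_inner_diff_right[OF assms(1) assms] frob_inner_diff_right[OF assms(2) assms] by simp
  finally show ?thesis .
qed

text \<open>V V^T is the sum of the rank one matrices v v^T over the columns v of \<open>V\<close>,
  and the inner product of v v^T with \<open>M\<close> is the quadratic form of \<open>M\<close> at
  v.\<close>

lemma frob_inner_projector:
  assumes V: "V \<in> carrier_mat d k" and M: "M \<in> carrier_mat d d"
  shows "frob_inner (V * transpose_mat V) M = (\<Sum>j<k. col V j \<bullet> (M *\<^sub>v col V j))"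
proof -
  have "(\<Sum>j<k. col V j \<bullet> (M *\<^sub>v col V j)) = (\<Sum>j<k. \<Sum>a<d. \<Sum>b<d. (col V j $ a * col V j $ b) * M $$ (a, b))"
    using V by (intro sum.cong refl quadratic_form_sum[OF M]) auto
  also have "\<dots> = (\<Sum>a<d. \<Sum>b<d. (\<Sum>j<k. col V j $ a * col V j $ b) * M $$ (a, b))"
    unfolding sum_distrib_right by (rule sum_swap_triple)
  also have "\<dots> = (\<Sum>a<d. \<Sum>b<d. (V * transpose_mat V) $$ (a, b) * M $$ (a, b))"
    using V by (intro sum.cong refl) (simp add: scalar_prod_def lessThan_atLeast0)
  also have "\<dots> = frob_inner (V * transpose_mat V) M"
    using V M by (intro frob_inner_sum[symmetric]) auto
  finally show ?thesis by simp
qed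

text \<open>Evaluate the trace of A W in the eigenbasis and move \<open>A\<close> to the left factor
  by symmetry. Only the diagonal of \<open>W\<close> in that basis survives.\<close>

lemma frob_inner_eigenbasis:
  assumes A: "A \<in> carrier_mat d d" "transpose_mat A = A" and W: "W \<in> carrier_mat d d"
    and q: "orthonormal d d q" and ev: "\<And>i. i < d \<Longrightarrow> A *\<^sub>v q i = \<nu> i \<cdot>\<^sub>v q i"
  shows "frob_inner A W = (\<Sum>i<d. \<nu> i * (q i \<bullet> (W *\<^sub>v q i)))"
proof -
  have "frob_inner A W = (\<Sum>i<d. q i \<bullet> ((A * W) *\<^sub>v q i))"
    unfolding frob_inner_def A(2) by (rule mtrace_orthonormal[OF q]) (use A W in simp)
  also have "\<dots> = (\<Sum>i<d. \<nu> i * (q i \<bullet> (W *\<^sub>v q i)))"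
  proof (intro sum.cong refl)
    fix i assume "i \<in> {..<d}"
    then have i: "i < d" and qi: "q i \<in> carrier_vec d" using q by (auto simp: orthonormal_def)
    have Wq: "W *\<^sub>v q i \<in> carrier_vec d" using W qi by simp
    have "q i \<bullet> ((A * W) *\<^sub>v q i) = q i \<bullet> (A *\<^sub>v (W *\<^sub>v q i))"
      using assoc_mult_mat_vec[OF A(1) W qi] by simp
    also have "\<dots> = (A *\<^sub>v q i) \<bullet> (W *\<^sub>v q i)" by (rule symmetric_mat_scalar_prod[OF A qi Wq])
    also have "\<dots> = \<nu> i * (q i \<bullet> (W *\<^sub>v q i))" using qi Wq by (simp add: ev[OF i])
    finally show "q i \<bullet> ((A * W) *\<^sub>v q i) = \<nu> i * (q i \<bullet> (W *\<^sub>v q i))" .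
  qed
  finally show ?thesis .
qed

text \<open>All eigenvalues lie in [0, 1], so each of their squares is at most the eigenvalue
  itself.\<close>

lemma frob_norm_sq_le_mtrace:
  assumes A: "A \<in> carrier_mat d d" "transpose_mat A = A"
    and lo: "\<And>x. x \<in> carrier_vec d \<Longrightarrow> 0 \<le> x \<bullet> (A *\<^sub>v x)"
    and hi: "\<And>x. x \<in> carrier_vec d \<Longrightarrow> x \<bullet> (A *\<^sub>v x) \<le> x \<bullet> x"
  shows "frob_inner A A \<le> mtrace A"
proof -
  obtain q \<nu> where q: "orthonormal d d q" "\<And>i. i < d \<Longrightarrow> A *\<^sub>v q i = \<nu> i \<cdot>\<^sub>v q i"
    using extend_to_eigenbasis[OF A, of 0 undefined undefined] by (auto simp: orthonormal_def)
  have "\<nu> i * (q i \<bullet> (A *\<^sub>v q i)) \<le> q i \<bullet> (A *\<^sub>v q i)" if i: "i < d" for i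
  proof -
    have qi: "q i \<in> carrier_vec d" "q i \<bullet> q i = 1" using q(1) i by (auto simp: orthonormal_def)
    have "q i \<bullet> (A *\<^sub>v q i) = \<nu> i" using qi by (simp add: q(2)[OF i])
    then have "0 \<le> \<nu> i" "\<nu> i \<le> 1" using lo[OF qi(1)] hi[OF qi(1)] qi(2) by auto
    then show ?thesis using lo[OF qi(1)] by (simp add: mult_left_le_one_le)
  qed
  then have "(\<Sum>i<d. \<nu> i * (q i \<bullet> (A *\<^sub>v q i))) \<le> (\<Sum>i<d. q i \<bullet> (A *\<^sub>v q i))"
    by (intro sum_mono) auto
  then show ?thesis
    using frob_inner_eigenbasis[OF A A(1) q] mtrace_orthonormal[OF q(1) A(1)] by simp
qed

section \<open>The Fantope and its curvature\<close>

text \<open>Replaces the Loewner constraints by bounds on the quadratic form, the shape in which the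
  estimates use them.\<close>

lemma fantopeD:
  assumes "W \<in> fantope d k"
  shows "W \<in> carrier_mat d d" "transpose_mat W = W" "mtrace W = real k"
    "\<And>x. x \<in> carrier_vec d \<Longrightarrow> 0 \<le> x \<bullet> (W *\<^sub>v x)"
    "\<And>x. x \<in> carrier_vec d \<Longrightarrow> x \<bullet> (W *\<^sub>v x) \<le> x \<bullet> x"
proof -
  have W: "W \<in> carrier_mat d d" and p0: "psd d (W - 0\<^sub>m d d)" and p1: "psd d (1\<^sub>m d - W)"
    and "mtrace W = real k"
    using assms by (auto simp: fantope_def loewner_le_def)
  have W0: "W - 0\<^sub>m d d = W" using W by (intro eq_matI) auto
  show "W \<in> carrier_mat d d" "mtrace W = real k" by fact+
  show "transpose_mat W = W" using p0 W0 by (simp add: psd_def)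
  show "0 \<le> x \<bullet> (W *\<^sub>v x)" if "x \<in> carrier_vec d" for x using p0 W0 that by (simp add: psd_def)
  show "x \<bullet> (W *\<^sub>v x) \<le> x \<bullet> x" if x: "x \<in> carrier_vec d" for x
  proof -
    have Wx: "W *\<^sub>v x \<in> carrier_vec d" using W x by simp
    have "0 \<le> x \<bullet> ((1\<^sub>m d - W) *\<^sub>v x)" using p1 x by (simp add: psd_def)
    also have "(1\<^sub>m d - W) *\<^sub>v x = x - W *\<^sub>v x"
      using W x by (simp add: minus_mult_distrib_mat_vec[of _ d d])
    finally show ?thesis using x Wx by (simp add: scalar_prod_minus_distrib)
  qed
qed

lemma fantopeI:
  assumes W: "W \<in> carrier_mat d d" "transpose_mat W = W" "mtrace W = real k"
    and lo: "\<And>x. x \<in> carrier_vec d \<Longrightarrow> 0 \<le> x \<bullet> (W *\<^sub>v x)"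
    and hi: "\<And>x. x \<in> carrier_vec d \<Longrightarrow> x \<bullet> (W *\<^sub>v x) \<le> x \<bullet> x"
  shows "W \<in> fantope d k"
proof -
  have W0: "W - 0\<^sub>m d d = W" using W by (intro eq_matI) auto
  have "psd d (1\<^sub>m d - W)" unfolding psd_def
  proof (intro conjI ballI)
    show "transpose_mat (1\<^sub>m d - W) = 1\<^sub>m d - W"
      using W by (simp add: transpose_minus[of _ d d])
    fix x :: "real vec" assume x: "x \<in> carrier_vec d"
    have Wx: "W *\<^sub>v x \<in> carrier_vec d" using W x by simp
    have "(1\<^sub>m d - W) *\<^sub>v x = x - W *\<^sub>v x"
      using W x by (simp add: minus_mult_distrib_mat_vec[of _ d d])
    then show "0 \<le> x \<bullet> ((1\<^sub>m d - W) *\<^sub>v x)" using hi[OF x] x Wx by (simp add: scalar_prod_minus_distrib)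
  qed (use W in \<open>intro minus_carrier_mat\<close>)
  moreover have "psd d W" using W lo by (simp add: psd_def)
  ultimately show ?thesis using W W0 by (simp add: fantope_def loewner_le_def)
qed

lemma projector_quadratic_form:
  assumes V: "V \<in> carrier_mat d k" and x: "x \<in> carrier_vec d"
  shows "x \<bullet> ((V * transpose_mat V) *\<^sub>v x) = (\<Sum>j<k. (col V j \<bullet> x)\<^sup>2 :: real)"
proof -
  have T: "transpose_mat V \<in> carrier_mat k d" using V by simp
  have y: "transpose_mat V *\<^sub>v x \<in> carrier_vec k" using T x by simp
  have "x \<bullet> ((V * transpose_mat V) *\<^sub>v x) = x \<bullet> (V *\<^sub>v (transpose_mat V *\<^sub>v x))"
    using assoc_mult_mat_vec[OF V T x] by simp
  also have "\<dots> = (transpose_mat V *\<^sub>v x) \<bullet> (transpose_mat V *\<^sub>v x)"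
    using transpose_vec_mult_scalar[OF V y x] by simp
  also have "\<dots> = (\<Sum>j<k. (col V j \<bullet> x)\<^sup>2)"
    unfolding scalar_prod_sum[OF y y] using V by (intro sum.cong refl) (simp add: power2_eq_square)
  finally show ?thesis .
qed

lemma bessel:
  assumes p: "orthonormal d k p" and k: "k \<le> d" and x: "x \<in> carrier_vec d"
  shows "(\<Sum>j<k. (p j \<bullet> x)\<^sup>2) \<le> x \<bullet> (x :: real vec)"
proof -
  \<comment> \<open>Every vector is an eigenvector of the identity, so eigenbasis extension becomes
    plain completion of an orthonormal family; Bessel is then Parseval with terms dropped.\<close>
  have ev: "1\<^sub>m d *\<^sub>v p i = 1 \<cdot>\<^sub>v p i" if "i < k" for i using p that by (auto simp: orthonormal_def)
  obtain q where q: "orthonormal d d q" and qp: "\<And>i. i < k \<Longrightarrow> q i = p i"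
    using extend_to_eigenbasis[of "1\<^sub>m d" d k p "\<lambda>_. 1", OF _ _ k p ev] by auto
  have "(\<Sum>j<k. (p j \<bullet> x)\<^sup>2) = (\<Sum>j<k. (q j \<bullet> x)\<^sup>2)" using qp by simp
  also have "\<dots> \<le> (\<Sum>j<d. (q j \<bullet> x)\<^sup>2)" using k by (intro sum_mono2) auto
  also have "\<dots> = x \<bullet> x" using parseval[OF q x x] by (simp add: power2_eq_square)
  finally show ?thesis .
qed

text \<open>Makes the true projector a feasible competitor in the penalized problem. The upper
  Loewner bound is Bessel's inequality.\<close>

lemma projector_in_fantope:
  assumes V: "V \<in> carrier_mat d k" "transpose_mat V * V = 1\<^sub>m k" and k: "k \<le> d"
  shows "V * transpose_mat V \<in> fantope d k"
proof (rule fantopeI)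
  have on: "orthonormal d k (col V)" by (rule orthonormal_cols[OF V])
  show P: "V * transpose_mat V \<in> carrier_mat d d" using V by simp
  show sym: "transpose_mat (V * transpose_mat V) = V * transpose_mat V"
    using V transpose_mult[of V d k "transpose_mat V" d] by simp
  have "mtrace (V * transpose_mat V) = frob_inner (V * transpose_mat V) (1\<^sub>m d)"
    unfolding frob_inner_def sym right_mult_one_mat[OF P] ..
  also have "\<dots> = (\<Sum>j<k. col V j \<bullet> col V j)"
    unfolding frob_inner_projector[OF V(1) one_carrier_mat] using V by (intro sum.cong refl) simp
  also have "\<dots> = real k" using on by (simp add: orthonormal_def)
  finally show "mtrace (V * transpose_mat V) = real k" .
  show "0 \<le> x \<bullet> (V * transpose_mat V *\<^sub>v x)" if "x \<in> carrier_vec d" for x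
    unfolding projector_quadratic_form[OF V(1) that] by (simp add: sum_nonneg)
  show "x \<bullet> (V * transpose_mat V *\<^sub>v x) \<le> x \<bullet> x" if "x \<in> carrier_vec d" for x
    unfolding projector_quadratic_form[OF V(1) that] by (rule bessel[OF on k that])
qed

lemma fantope_frob_inner_self: "W \<in> fantope d k \<Longrightarrow> frob_inner W W \<le> real k"
  using frob_norm_sq_le_mtrace[of W d] fantopeD[of W d k] by simp

text \<open>The gap times k - <R, W>, with R = V V^T, bounds the loss of objective from below, and
  |R - W|^2 is at most 2 (k - <R, W>) because both matrices have squared norm at most k. Positivity
  of the gap is not assumed, which allows a second use with an estimated matrix in the role of
  \<open>A\<close>.\<close>

lemma fantope_curvature:
  assumes A: "A \<in> carrier_mat d d" "transpose_mat A = A"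
    and V: "top_eigvecs d k A V" and k: "1 \<le> k" "k < d" and W: "W \<in> fantope d k"
  shows "(eig A k - eig A (k + 1)) / 2 * (frob_norm (V * transpose_mat V - W))\<^sup>2
    \<le> frob_inner A (V * transpose_mat V) - frob_inner A W"
proof -
  define R where "R = V * transpose_mat V"
  have V': "V \<in> carrier_mat d k" "transpose_mat V * V = 1\<^sub>m k" using V by (auto simp: top_eigvecs_def)
  have R: "R \<in> fantope d k" unfolding R_def using projector_in_fantope[OF V'] k by simp
  note W' = fantopeD[OF W] and R' = fantopeD[OF R]
  obtain q \<nu> where q: "orthonormal d d q" "\<And>i. i < d \<Longrightarrow> A *\<^sub>v q i = \<nu> i \<cdot>\<^sub>v q i"
    and qV: "\<And>i. i < k \<Longrightarrow> q i = col V i" and top: "\<And>i. i < k \<Longrightarrow> eig A k \<le> \<nu> i"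
    and bot: "\<And>i. k \<le> i \<Longrightarrow> i < d \<Longrightarrow> \<nu> i \<le> eig A (k + 1)"
    using top_eigvecs_eigenbasis[OF A V k] by blast
  define p where "p i = q i \<bullet> (W *\<^sub>v q i)" for i
  have qi: "q i \<in> carrier_vec d" "q i \<bullet> q i = 1" if "i < d" for i
    using q(1) that by (auto simp: orthonormal_def)
  have p: "0 \<le> p i" "p i \<le> 1" if "i < d" for i
    using W'(4)[OF qi(1)[OF that]] W'(5)[OF qi(1)[OF that]] qi(2)[OF that] by (simp_all add: p_def)
  have split: "{..<d} = {..<k} \<union> {k..<d}" "{..<k} \<inter> {k..<d} = {}" using k by auto
  have sumsplit: "(\<Sum>i<d. f i) = (\<Sum>i<k. f i) + (\<Sum>i=k..<d. f i)" for f :: "nat \<Rightarrow> real"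
    unfolding split(1) by (rule sum.union_disjoint) (use split(2) in auto)
  have tr: "(\<Sum>i<d. p i) = real k" using mtrace_orthonormal[OF q(1) W'(1)] W'(3) by (simp add: p_def)
  have RW: "frob_inner R W = (\<Sum>i<k. p i)"
    unfolding R_def frob_inner_projector[OF V'(1) W'(1)] using qV by (simp add: p_def)
  have AR: "frob_inner A R = (\<Sum>i<k. \<nu> i)"
  proof -
    have "frob_inner A R = frob_inner R A" using frob_inner_comm[OF A(1) R'(1)] .
    also have "\<dots> = (\<Sum>i<k. q i \<bullet> (A *\<^sub>v q i))"
      unfolding R_def frob_inner_projector[OF V'(1) A(1)] using qV by simp
    also have "\<dots> = (\<Sum>i<k. \<nu> i)" using k qi by (intro sum.cong refl) (simp add: q(2))
    finally show ?thesis .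
  qed
  have AW: "frob_inner A W = (\<Sum>i<d. \<nu> i * p i)"
    using frob_inner_eigenbasis[OF A W'(1) q] by (simp add: p_def)
  \<comment> \<open>Since the \<open>p i\<close> sum to k, the mass missing on the first k
    directions equals the mass on the others, and both equal k - <R, W>. One copy is weighted with
    \<open>eig A k\<close>, the other with \<open>eig A (k + 1)\<close>.\<close>
  have "(eig A k - eig A (k + 1)) * (real k - frob_inner R W)
      = (\<Sum>i<k. eig A k * (1 - p i)) - (\<Sum>i=k..<d. eig A (k + 1) * p i)"
  proof -
    have "(\<Sum>i<k. eig A k * (1 - p i)) = eig A k * (real k - (\<Sum>i<k. p i))"
      by (simp add: sum_distrib_left[symmetric] sum_subtractf)
    moreover have "(\<Sum>i=k..<d. eig A (k + 1) * p i) = eig A (k + 1) * (real k - (\<Sum>i<k. p i))"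
      using tr sumsplit[of p] by (simp add: sum_distrib_left[symmetric])
    ultimately show ?thesis unfolding RW by (simp add: algebra_simps)
  qed
  also have "\<dots> \<le> (\<Sum>i<k. \<nu> i * (1 - p i)) - (\<Sum>i=k..<d. \<nu> i * p i)"
    using top bot p k by (intro diff_mono sum_mono mult_right_mono) auto
  also have "\<dots> = frob_inner A R - frob_inner A W"
    unfolding AR AW sumsplit by (simp add: algebra_simps sum_subtractf)
  finally have gap: "(eig A k - eig A (k + 1)) * (real k - frob_inner R W) \<le> frob_inner A R - frob_inner A W" .
  have "(frob_norm (R - W))\<^sup>2 \<le> 2 * (real k - frob_inner R W)"
    using frob_norm_diff_sq[OF R'(1) W'(1)] fantope_frob_inner_self[OF R] fantope_frob_inner_self[OF W] by simp
  then have "(eig A k - eig A (k + 1)) / 2 * (frob_norm (R - W))\<^sup>2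
      \<le> (eig A k - eig A (k + 1)) / 2 * (2 * (real k - frob_inner R W))"
    using eig_Suc_le[OF A k] by (intro mult_left_mono) auto
  also have "\<dots> = (eig A k - eig A (k + 1)) * (real k - frob_inner R W)" by simp
  also note gap
  finally show ?thesis unfolding R_def .
qed

section \<open>Orthogonal alignment of two frames\<close>

text \<open>Zero vectors mark open slots, and each is replaced by a unit vector orthogonal to all
  the others; the induction counts the open slots. This covers singular matrices in the polar
  decomposition.\<close>

lemma complete_partial_orthonormal:
  assumes "\<And>i. i < d \<Longrightarrow> p i \<in> carrier_vec d"
    and "\<And>i j. i < d \<Longrightarrow> j < d \<Longrightarrow> i \<noteq> j \<Longrightarrow> p i \<bullet> p j = (0::real)"
    and "\<And>i. i < d \<Longrightarrow> p i \<bullet> p i = 1 \<or> p i = 0\<^sub>v d"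
  shows "\<exists>r. orthonormal d d r \<and> (\<forall>i<d. p i \<noteq> 0\<^sub>v d \<longrightarrow> r i = p i)"
  using assms
proof (induction "card {i. i < d \<and> p i = 0\<^sub>v d}" arbitrary: p)
  case 0
  then have "p i \<noteq> 0\<^sub>v d" if "i < d" for i using that by auto
  then have "orthonormal d d p" using 0 by (auto simp: orthonormal_def)
  then show ?case by blast
next
  case (Suc c)
  note p = Suc.prems
  have "{i. i < d \<and> p i = 0\<^sub>v d} \<noteq> {}" using Suc.hyps(2) by force
  then obtain m where m: "m < d" "p m = 0\<^sub>v d" by blast
  obtain x where x: "x \<in> carrier_vec d" "x \<bullet> x = 1" "\<And>i. i < d \<Longrightarrow> p i \<bullet> x = 0"
    using exists_unit_orthogonal_of_zero[of d p m, OF p(1) m] by blast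
  have x': "x \<bullet> p i = 0" if "i < d" for i
    using x(3)[OF that] comm_scalar_prod[OF x(1) p(1)[OF that]] by simp
  have "x \<noteq> 0\<^sub>v d" using x(2) by auto
  then have "{i. i < d \<and> (p(m := x)) i = 0\<^sub>v d} = {i. i < d \<and> p i = 0\<^sub>v d} - {m}" by auto
  then have "c = card {i. i < d \<and> (p(m := x)) i = 0\<^sub>v d}"
    using Suc.hyps(2) m by (simp add: card_Diff_singleton)
  moreover have "(p(m := x)) i \<in> carrier_vec d" if "i < d" for i using p(1)[OF that] x(1) by simp
  moreover have "(p(m := x)) i \<bullet> (p(m := x)) j = 0" if "i < d" "j < d" "i \<noteq> j" for i j
    using p(2)[OF that] x(3)[OF that(1)] x'[OF that(2)] that(3) by (cases "i = m"; cases "j = m") simp_all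
  moreover have "(p(m := x)) i \<bullet> (p(m := x)) i = 1 \<or> (p(m := x)) i = 0\<^sub>v d" if "i < d" for i
    using p(3)[OF that] x(2) by (cases "i = m") simp_all
  ultimately obtain r where r: "orthonormal d d r" "\<forall>i<d. (p(m := x)) i \<noteq> 0\<^sub>v d \<longrightarrow> r i = (p(m := x)) i"
    using Suc.hyps(1)[of "p(m := x)"] by blast
  have "r i = p i" if "i < d" "p i \<noteq> 0\<^sub>v d" for i
    using r(2) that m by (cases "i = m") auto
  with r(1) show ?case by blast
qed

text \<open>A zero \<open>b i\<close> has no direction of its own, so completion assigns it one; the
  factorization survives because its length factor is 0.\<close>

lemma normalize_orthogonal_family:
  assumes b: "\<And>i. i < d \<Longrightarrow> b i \<in> carrier_vec d"
    and orth: "\<And>i j. i < d \<Longrightarrow> j < d \<Longrightarrow> i \<noteq> j \<Longrightarrow> b i \<bullet> b j = (0::real)"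
  shows "\<exists>p. orthonormal d d p \<and> (\<forall>i<d. b i = sqrt (b i \<bullet> b i) \<cdot>\<^sub>v p i)"
proof -
  define p where "p i = (1 / sqrt (b i \<bullet> b i)) \<cdot>\<^sub>v b i" for i
  have zero: "p i = 0\<^sub>v d" if "b i = 0\<^sub>v d" for i
    using that by (auto simp: p_def intro!: eq_vecI)
  have unit: "p i \<bullet> p i = 1 \<and> b i = sqrt (b i \<bullet> b i) \<cdot>\<^sub>v p i" if i: "i < d" and "b i \<noteq> 0\<^sub>v d" for i
  proof -
    have "b i \<bullet> b i > 0" using scalar_prod_self_pos[OF b[OF i]] that by blast
    then show ?thesis using b[OF i] by (simp add: p_def smult_smult_assoc)
  qed
  have "\<exists>r. orthonormal d d r \<and> (\<forall>i<d. p i \<noteq> 0\<^sub>v d \<longrightarrow> r i = p i)"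
  proof (rule complete_partial_orthonormal)
    show "p i \<in> carrier_vec d" if "i < d" for i using b[OF that] by (simp add: p_def)
    show "p i \<bullet> p j = 0" if "i < d" "j < d" "i \<noteq> j" for i j
      using orth[OF that] b[OF that(1)] b[OF that(2)] by (simp add: p_def)
    show "p i \<bullet> p i = 1 \<or> p i = 0\<^sub>v d" if "i < d" for i
      using zero unit[OF that] by blast
  qed
  then obtain r where r: "orthonormal d d r" "\<And>i. i < d \<Longrightarrow> p i \<noteq> 0\<^sub>v d \<Longrightarrow> r i = p i" by blast
  have "b i = sqrt (b i \<bullet> b i) \<cdot>\<^sub>v r i" if i: "i < d" for i
  proof (cases "b i = 0\<^sub>v d")
    case True
    have "r i \<in> carrier_vec d" using r(1) i by (simp add: orthonormal_def)
    then show ?thesis unfolding True by (intro eq_vecI) auto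
  next
    case False
    then have u: "p i \<bullet> p i = 1" "b i = sqrt (b i \<bullet> b i) \<cdot>\<^sub>v p i" using unit[OF i] by blast+
    have "p i \<noteq> 0\<^sub>v d" using u(1) by auto
    then show ?thesis using r(2)[OF i] u(2) by metis
  qed
  with r(1) show ?thesis by blast
qed

text \<open>The orthogonal factor of a polar decomposition. It turns an orthonormal eigenbasis \<open>r\<close> of
  \<open>B\<^sup>T B\<close> into normalized versions of the orthogonal vectors \<open>B r\<^sub>j\<close>, so that
  \<open>frob_inner Q B\<close> is the sum of the singular values of \<open>B\<close>.\<close>
lemma contraction_polar:
  assumes B: "B \<in> carrier_mat k k"
    and contr: "\<And>x. x \<in> carrier_vec k \<Longrightarrow> (B *\<^sub>v x) \<bullet> (B *\<^sub>v x) \<le> x \<bullet> (x :: real vec)"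
  shows "\<exists>Q \<in> orth_mats k. frob_inner B B \<le> frob_inner Q B"
proof -
  have BT: "transpose_mat B \<in> carrier_mat k k" using B by simp
  have G: "transpose_mat B * B \<in> carrier_mat k k" "transpose_mat (transpose_mat B * B) = transpose_mat B * B"
    using B transpose_mult[OF BT B] by simp_all
  obtain r \<nu> where r: "orthonormal k k r" "\<And>i. i < k \<Longrightarrow> (transpose_mat B * B) *\<^sub>v r i = \<nu> i \<cdot>\<^sub>v r i"
    using extend_to_eigenbasis[OF G, of 0 undefined undefined] by (auto simp: orthonormal_def)
  have rc: "r i \<in> carrier_vec k" if "i < k" for i using r(1) that by (simp add: orthonormal_def)
  define b where "b i = B *\<^sub>v r i" for i
  have b: "b i \<in> carrier_vec k" if "i < k" for i using B rc[OF that] by (simp add: b_def)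
  \<comment> \<open>The trace of M^T B is computed in the basis \<open>r\<close>, which reduces both
    inner products in the claim to sums over the vectors \<open>b i\<close>.\<close>
  have trace: "frob_inner M B = (\<Sum>i<k. (M *\<^sub>v r i) \<bullet> b i)" if M: "M \<in> carrier_mat k k" for M
  proof -
    have MT: "transpose_mat M \<in> carrier_mat k k" using M by simp
    have "r i \<bullet> ((transpose_mat M * B) *\<^sub>v r i) = (M *\<^sub>v r i) \<bullet> b i" if i: "i < k" for i
    proof -
      have "r i \<bullet> ((transpose_mat M * B) *\<^sub>v r i) = r i \<bullet> (transpose_mat M *\<^sub>v b i)"
        using assoc_mult_mat_vec[OF MT B rc[OF i]] by (simp add: b_def)
      also have "\<dots> = (M *\<^sub>v r i) \<bullet> b i"
        using transpose_vec_mult_scalar[OF MT b[OF i] rc[OF i]] M by simp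
      finally show ?thesis .
    qed
    then show ?thesis
      unfolding frob_inner_def using mtrace_orthonormal[OF r(1), of "transpose_mat M * B"] MT B by simp
  qed
  have orth: "b i \<bullet> b j = 0" if "i < k" "j < k" "i \<noteq> j" for i j
  proof -
    have "b i \<bullet> b j = r i \<bullet> (transpose_mat B *\<^sub>v b j)"
      using transpose_vec_mult_scalar[OF BT b[OF that(2)] rc[OF that(1)]] by (simp add: b_def)
    also have "\<dots> = r i \<bullet> (\<nu> j \<cdot>\<^sub>v r j)"
      using assoc_mult_mat_vec[OF BT B rc[OF that(2)]] r(2)[OF that(2)] by (simp add: b_def)
    also have "\<dots> = 0"
    proof -
      have "r i \<bullet> r j = 0" using r(1) that by (simp add: orthonormal_def)
      then show ?thesis using rc[OF that(1)] rc[OF that(2)] by simp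
    qed
    finally show ?thesis .
  qed
  obtain p where p: "orthonormal k k p" "\<And>i. i < k \<Longrightarrow> b i = sqrt (b i \<bullet> b i) \<cdot>\<^sub>v p i"
    using normalize_orthogonal_family[of k b, OF b orth] by blast
  \<comment> \<open>\<open>P\<close> and \<open>R\<close> have the columns \<open>p i\<close> and
    \<open>r i\<close>, so P R^T is orthogonal and sends \<open>r i\<close> to
    \<open>p i\<close>.\<close>
  define P where "P = mat_of_family k p"
  define R where "R = mat_of_family k r"
  have P: "P \<in> carrier_mat k k" and R: "R \<in> carrier_mat k k" and RT: "transpose_mat R \<in> carrier_mat k k"
    by (simp_all add: P_def R_def)
  have PR: "P * transpose_mat R \<in> carrier_mat k k" using P R by simp
  have "transpose_mat (P * transpose_mat R) * (P * transpose_mat R) = R * (transpose_mat P * P) * transpose_mat R"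
    using P R RT transpose_mult[OF P RT] by (simp add: assoc_mult_mat[of _ k k _ k _ k])
  also have "\<dots> = 1\<^sub>m k"
    using mat_of_family_orthogonal[OF p(1)] mat_of_family_orthogonal[OF r(1)] R by (simp add: P_def R_def)
  finally have Q: "P * transpose_mat R \<in> orth_mats k" using PR by (simp add: orth_mats_def)
  have Qr: "(P * transpose_mat R) *\<^sub>v r i = p i" if i: "i < k" for i
  proof -
    have "transpose_mat R *\<^sub>v r i = unit_vec k i"
      using R r(1) i by (intro eq_vecI) (auto simp: R_def col_mat_of_family[OF r(1)] orthonormal_def)
    then have "(P * transpose_mat R) *\<^sub>v r i = P *\<^sub>v unit_vec k i"
      using assoc_mult_mat_vec[OF P RT rc[OF i]] by simp
    also have "\<dots> = col P i" using P i by (intro eq_vecI) auto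
    also have "\<dots> = p i" using i by (simp add: P_def col_mat_of_family[OF p(1)])
    finally show ?thesis .
  qed
  have "frob_inner B B = (\<Sum>i<k. b i \<bullet> b i)" using trace[OF B] by (simp add: b_def)
  also have "\<dots> \<le> (\<Sum>i<k. p i \<bullet> b i)"
  proof (intro sum_mono)
    fix i assume "i \<in> {..<k}"
    then have i: "i < k" by simp
    have pc: "p i \<in> carrier_vec k" "p i \<bullet> p i = 1" using p(1) i by (auto simp: orthonormal_def)
    have nn: "0 \<le> b i \<bullet> b i" unfolding scalar_prod_sum[OF b[OF i] b[OF i]] by (simp add: sum_nonneg)
    have "b i \<bullet> b i \<le> 1" using contr[OF rc[OF i]] r(1) i by (simp add: b_def orthonormal_def)
    \<comment> \<open>The root of \<open>b i \<bullet> b i\<close> is a singular value of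
      \<open>B\<close>. The contraction hypothesis bounds it by 1, so it dominates its own
      square.\<close>
    then have "b i \<bullet> b i \<le> sqrt (b i \<bullet> b i)"
      using nn by (intro real_le_rsqrt) (simp add: power2_eq_square mult_left_le)
    also have "\<dots> = p i \<bullet> (sqrt (b i \<bullet> b i) \<cdot>\<^sub>v p i)" using pc by simp
    also have "\<dots> = p i \<bullet> b i" using p(2)[OF i] by simp
    finally show "b i \<bullet> b i \<le> p i \<bullet> b i" .
  qed
  also have "\<dots> = frob_inner (P * transpose_mat R) B" using trace[OF PR] Qr by simp
  finally show ?thesis using Q by blast
qed

lemma frob_inner_projector_self:
  assumes Z: "Z \<in> carrier_mat d k" "transpose_mat Z * Z = 1\<^sub>m k"
  shows "frob_inner (Z * transpose_mat Z) (Z * transpose_mat Z) = real k"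
proof -
  have on: "orthonormal d k (col Z)" by (rule orthonormal_cols[OF Z])
  have "frob_inner (Z * transpose_mat Z) (Z * transpose_mat Z) = (\<Sum>j<k. col Z j \<bullet> ((Z * transpose_mat Z) *\<^sub>v col Z j))"
    by (rule frob_inner_projector[OF Z(1)]) (use Z in simp)
  also have "\<dots> = (\<Sum>j<k. \<Sum>i<k. (col Z i \<bullet> col Z j)\<^sup>2)"
    using Z by (intro sum.cong refl projector_quadratic_form[OF Z(1)]) auto
  also have "\<dots> = (\<Sum>j<k. \<Sum>i<k. if i = j then 1 else 0)"
    using on by (intro sum.cong refl) (auto simp: orthonormal_def)
  finally show ?thesis by simp
qed

text \<open>With B = V^T U the two squared distances are 2k - 2 <Q, B> and 2k - 2 <B, B>, so
  \<open>contraction_polar\<close> decides the comparison. \<open>B\<close> is a contraction because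
  \<open>U\<close> preserves lengths and V^T does not increase them.\<close>

lemma exists_orthogonal_alignment:
  assumes V: "V \<in> carrier_mat d k" "transpose_mat V * V = 1\<^sub>m k"
    and U: "U \<in> carrier_mat d k" "transpose_mat U * U = 1\<^sub>m k" and k: "k \<le> d"
  shows "\<exists>Q \<in> orth_mats k.
    frob_norm (U - V * Q) \<le> frob_norm (U * transpose_mat U - V * transpose_mat V)"
proof -
  have VT: "transpose_mat V \<in> carrier_mat k d" and UT: "transpose_mat U \<in> carrier_mat k d" using V U by simp_all
  define B where "B = transpose_mat V * U"
  have B: "B \<in> carrier_mat k k" using V U by (simp add: B_def)
  have onV: "orthonormal d k (col V)" and onU: "orthonormal d k (col U)"
    using orthonormal_cols V U by blast+
  have Vsq: "(transpose_mat V *\<^sub>v y) \<bullet> (transpose_mat V *\<^sub>v y) = (\<Sum>j<k. (col V j \<bullet> y)\<^sup>2)"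
    if y: "y \<in> carrier_vec d" for y
  proof -
    have c: "transpose_mat V *\<^sub>v y \<in> carrier_vec k" using VT y by simp
    show ?thesis unfolding scalar_prod_sum[OF c c] using V by (intro sum.cong refl) (simp add: power2_eq_square)
  qed
  have "(B *\<^sub>v x) \<bullet> (B *\<^sub>v x) \<le> x \<bullet> x" if x: "x \<in> carrier_vec k" for x
  proof -
    have Ux: "U *\<^sub>v x \<in> carrier_vec d" using U x by simp
    have "B *\<^sub>v x = transpose_mat V *\<^sub>v (U *\<^sub>v x)" unfolding B_def by (rule assoc_mult_mat_vec[OF VT U(1) x])
    then have "(B *\<^sub>v x) \<bullet> (B *\<^sub>v x) \<le> (U *\<^sub>v x) \<bullet> (U *\<^sub>v x)" using Vsq[OF Ux] bessel[OF onV k Ux] by simp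
    also have "\<dots> = x \<bullet> (transpose_mat U *\<^sub>v (U *\<^sub>v x))"
      using transpose_vec_mult_scalar[OF UT Ux x] by simp
    also have "\<dots> = x \<bullet> x" using assoc_mult_mat_vec[OF UT U(1) x] U(2) x by simp
    finally show ?thesis .
  qed
  from contraction_polar[OF B this] obtain Q where Q: "Q \<in> orth_mats k" "frob_inner B B \<le> frob_inner Q B" by blast
  have Qc: "Q \<in> carrier_mat k k" "transpose_mat Q * Q = 1\<^sub>m k" using Q(1) by (auto simp: orth_mats_def)
  have QT: "transpose_mat Q \<in> carrier_mat k k" using Qc by simp
  have VQ: "V * Q \<in> carrier_mat d k" using V Qc by simp
  have TVQ: "transpose_mat (V * Q) = transpose_mat Q * transpose_mat V" by (rule transpose_mult[OF V(1) Qc(1)])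
  have tr1: "mtrace (1\<^sub>m k) = real k" by (simp add: mtrace_def)
  have i1: "frob_inner (V * Q) (V * Q) = real k"
  proof -
    have "transpose_mat (V * Q) * (V * Q) = transpose_mat Q * ((transpose_mat V * V) * Q)"
      unfolding TVQ by (simp only: assoc_mult_mat[OF QT VT VQ] assoc_mult_mat[OF VT V(1) Qc(1)])
    then show ?thesis using V(2) Qc tr1 by (simp add: frob_inner_def)
  qed
  have i2: "frob_inner U U = real k" using U(2) tr1 by (simp add: frob_inner_def)
  have i3: "frob_inner U (V * Q) = frob_inner Q B"
  proof -
    have "frob_inner U (V * Q) = frob_inner (V * Q) U" by (rule frob_inner_comm[OF U(1) VQ])
    also have "\<dots> = frob_inner Q B" unfolding frob_inner_def B_def TVQ
      using assoc_mult_mat[OF QT VT U(1)] by simp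
    finally show ?thesis .
  qed
  have i4: "frob_inner (U * transpose_mat U) (V * transpose_mat V) = frob_inner B B"
  proof -
    have "frob_inner (U * transpose_mat U) (V * transpose_mat V) = (\<Sum>j<k. col U j \<bullet> ((V * transpose_mat V) *\<^sub>v col U j))"
      by (rule frob_inner_projector[OF U(1)]) (use V in simp)
    also have "\<dots> = (\<Sum>j<k. \<Sum>i<k. (col V i \<bullet> col U j)\<^sup>2)"
      using U by (intro sum.cong refl projector_quadratic_form[OF V(1)]) auto
    also have "\<dots> = (\<Sum>i<k. \<Sum>j<k. (col V i \<bullet> col U j)\<^sup>2)" by (rule sum.swap)
    also have "\<dots> = frob_inner B B" unfolding frob_inner_sum[OF B B]
      using V U by (intro sum.cong refl) (simp add: B_def power2_eq_square)
    finally show ?thesis .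
  qed
  have UU: "U * transpose_mat U \<in> carrier_mat d d" and VV: "V * transpose_mat V \<in> carrier_mat d d" using U V by simp_all
  have "(frob_norm (U - V * Q))\<^sup>2 \<le> (frob_norm (U * transpose_mat U - V * transpose_mat V))\<^sup>2"
    unfolding frob_norm_diff_sq[OF U(1) VQ] frob_norm_diff_sq[OF UU VV] using i1 i2 i3 i4 frob_inner_projector_self[OF U] frob_inner_projector_self[OF V] Q(2) by simp
  then have "frob_norm (U - V * Q) \<le> frob_norm (U * transpose_mat U - V * transpose_mat V)"
    by (rule power2_le_imp_le) simp
  with Q(1) show ?thesis by blast
qed

section \<open>Deterministic error bound\<close>

text \<open>Entrywise (u + v)^2 is at most 2 u^2 + 2 v^2. Its use below has the same bound for both
  distances, where this loses nothing against the triangle inequality.\<close>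

lemma frob_norm_triangle_sq:
  assumes "A \<in> carrier_mat n m" "B \<in> carrier_mat n m" "C \<in> carrier_mat n m"
  shows "(frob_norm (A - C))\<^sup>2 \<le> 2 * (frob_norm (A - B))\<^sup>2 + 2 * (frob_norm (B - C))\<^sup>2"
proof -
  have sq: "(frob_norm (X - Y))\<^sup>2 = (\<Sum>a<n. \<Sum>b<m. (X $$ (a, b) - Y $$ (a, b))\<^sup>2)"
    if "X \<in> carrier_mat n m" "Y \<in> carrier_mat n m" for X Y
    using that by (simp add: frob_norm_def sum_nonneg)
  have "(x - z)\<^sup>2 \<le> 2 * (x - y)\<^sup>2 + 2 * (y - z)\<^sup>2" for x y z :: real
    using zero_le_power2[of "(x - y) - (y - z)"] by (simp add: power2_eq_square algebra_simps)
  then have "(\<Sum>a<n. \<Sum>b<m. (A $$ (a, b) - C $$ (a, b))\<^sup>2) \<le>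
      (\<Sum>a<n. \<Sum>b<m. 2 * (A $$ (a, b) - B $$ (a, b))\<^sup>2 + 2 * (B $$ (a, b) - C $$ (a, b))\<^sup>2)"
    by (intro sum_mono)
  then show ?thesis using assms by (simp add: sq sum.distrib sum_distrib_left)
qed

text \<open>The projector T = V V^T satisfies <W, T> >= <W, R> and has squared norm at most k, the
  squared norm of \<open>R\<close>. Expanding the squares shows that T is at least as near to
  \<open>W\<close> as \<open>R\<close> is.\<close>

lemma projector_error_le:
  assumes V: "top_eigvecs d k W V" and k: "1 \<le> k" "k < d" and W: "W \<in> fantope d k" and R: "R \<in> fantope d k"
    and RR: "frob_inner R R = real k"
  shows "frob_norm (V * transpose_mat V - R) \<le> 2 * frob_norm (R - W)"
proof -
  define T where "T = V * transpose_mat V"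
  note W' = fantopeD[OF W] and R' = fantopeD[OF R]
  have V': "V \<in> carrier_mat d k" "transpose_mat V * V = 1\<^sub>m k" using V by (auto simp: top_eigvecs_def)
  have T: "T \<in> fantope d k" unfolding T_def using projector_in_fantope[OF V'] k by simp
  note T' = fantopeD[OF T]
  \<comment> \<open>The k-th eigenvalue of \<open>W\<close> may be repeated, so only the sign of its
    gap is used.\<close>
  have "0 \<le> (eig W k - eig W (k + 1)) / 2 * (frob_norm (T - R))\<^sup>2"
    using eig_Suc_le[OF W'(1,2) k] by simp
  also have "\<dots> \<le> frob_inner W T - frob_inner W R"
    unfolding T_def by (rule fantope_curvature[OF W'(1,2) V k R])
  finally have "frob_inner W R \<le> frob_inner W T" by simp
  then have "(frob_norm (T - W))\<^sup>2 \<le> (frob_norm (R - W))\<^sup>2"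
    unfolding frob_norm_diff_sq[OF T'(1) W'(1)] frob_norm_diff_sq[OF R'(1) W'(1)]
    using frob_inner_comm[OF T'(1) W'(1)] frob_inner_comm[OF R'(1) W'(1)] fantope_frob_inner_self[OF T] RR by simp
  moreover have "(frob_norm (W - R))\<^sup>2 = (frob_norm (R - W))\<^sup>2"
    unfolding frob_norm_diff_sq[OF W'(1) R'(1)] frob_norm_diff_sq[OF R'(1) W'(1)]
    using frob_inner_comm[OF R'(1) W'(1)] by simp
  moreover have "(2 * frob_norm (R - W))\<^sup>2 = 4 * (frob_norm (R - W))\<^sup>2" by (simp add: power_mult_distrib)
  ultimately have "(frob_norm (T - R))\<^sup>2 \<le> (2 * frob_norm (R - W))\<^sup>2"
    using frob_norm_triangle_sq[OF T'(1) W'(1) R'(1)] by linarith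
  then show ?thesis unfolding T_def by (rule power2_le_imp_le) simp
qed

text \<open>Noise and penalty are balanced entry by entry. Outside the support block the penalty
  paid by \<open>W\<close> absorbs the noise; inside, Cauchy-Schwarz turns the sum of absolute
  differences into \<open>s\<close> times the Frobenius error.\<close>

lemma penalized_maximizer_error:
  assumes A: "A \<in> carrier_mat d d" "transpose_mat A = A" and S: "S \<in> carrier_mat d d"
    and V: "top_eigvecs d k A V" and k: "1 \<le> k" "k < d" and s: "nonzero_rows V \<le> s"
    and lam: "0 \<le> lam" and dev: "\<And>a b. a < d \<Longrightarrow> b < d \<Longrightarrow> \<bar>S $$ (a, b) - A $$ (a, b)\<bar> \<le> lam / 4"
    and W: "is_maximizer d k lam S W"
  shows "(eig A k - eig A (k + 1)) * frob_norm (V * transpose_mat V - W) \<le> 5 / 2 * lam * real s"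
proof -
  define R where "R = V * transpose_mat V"
  define F where "F = frob_norm (R - W)"
  define \<rho> where "\<rho> = eig A k - eig A (k + 1)"
  \<comment> \<open>The row support of \<open>V\<close>. Entry (a, b) of \<open>R\<close> is the
    product of rows a and b of \<open>V\<close>, so \<open>R\<close> vanishes off J x J.\<close>
  define J where "J = {j. j < d \<and> (\<exists>c<k. V $$ (j, c) \<noteq> 0)}"
  have V': "V \<in> carrier_mat d k" "transpose_mat V * V = 1\<^sub>m k" using V by (auto simp: top_eigvecs_def)
  have R: "R \<in> fantope d k" unfolding R_def using projector_in_fantope[OF V'] k by simp
  have Wf: "W \<in> fantope d k"
    and opt: "frob_inner R S - lam * entry_l1 R \<le> frob_inner W S - lam * entry_l1 W"
    using W R by (auto simp: is_maximizer_def)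
  note W' = fantopeD[OF Wf] and R' = fantopeD[OF R]
  have Jd: "J \<subseteq> {..<d}" and fJ: "finite J" by (auto simp: J_def)
  have cJ: "card J \<le> s" using s V'(1) by (simp add: nonzero_rows_def J_def)
  have R0: "R $$ (a, b) = 0" if "a < d" "b < d" "a \<notin> J \<or> b \<notin> J" for a b
    using that V'(1) by (auto simp: R_def scalar_prod_def J_def intro!: sum.neutral)
  define D where "D a b = \<bar>R $$ (a, b) - W $$ (a, b)\<bar>" for a b
  \<comment> \<open>The factor 5/4 adds noise lam / 4 to a penalty change of at most lam. Where
    \<open>R\<close> is 0, \<open>D a b\<close> is the size of the entry of \<open>W\<close>, and
    lam times it covers lam / 4 times it.\<close>
  have pt: "A $$ (a, b) * R $$ (a, b) - A $$ (a, b) * W $$ (a, b) \<le>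
      (R $$ (a, b) * S $$ (a, b) - W $$ (a, b) * S $$ (a, b)) - lam * \<bar>R $$ (a, b)\<bar> + lam * \<bar>W $$ (a, b)\<bar>
      + (if a \<in> J \<and> b \<in> J then 5 / 4 * lam * D a b else 0)"
    if ab: "a < d" "b < d" for a b
  proof -
    have "(A $$ (a, b) - S $$ (a, b)) * (R $$ (a, b) - W $$ (a, b))
        \<le> \<bar>S $$ (a, b) - A $$ (a, b)\<bar> * D a b"
      unfolding D_def by (metis abs_ge_self abs_minus_commute abs_mult)
    also have "\<dots> \<le> lam / 4 * D a b" using dev[OF ab] by (intro mult_right_mono) (auto simp: D_def)
    finally have 1: "(A $$ (a, b) - S $$ (a, b)) * (R $$ (a, b) - W $$ (a, b)) \<le> lam / 4 * D a b" .
    have 2: "lam * \<bar>R $$ (a, b)\<bar> \<le> lam * \<bar>W $$ (a, b)\<bar> + lam * D a b"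
      using mult_left_mono[OF _ lam, of "\<bar>R $$ (a, b)\<bar>" "\<bar>W $$ (a, b)\<bar> + D a b"]
      by (simp add: D_def distrib_left)
    show ?thesis
    proof (cases "a \<in> J \<and> b \<in> J")
      case True then show ?thesis using 1 2 by (simp add: algebra_simps)
    next
      case False
      then have "R $$ (a, b) = 0" using R0 ab by blast
      moreover have "0 \<le> lam * \<bar>W $$ (a, b)\<bar>" using lam by simp
      ultimately show ?thesis using 1 False by (auto simp: algebra_simps D_def)
    qed
  qed
  have "\<rho> / 2 * F\<^sup>2 \<le> frob_inner A R - frob_inner A W"
    unfolding \<rho>_def F_def R_def by (rule fantope_curvature[OF A V k Wf])
  also have "\<dots> = (\<Sum>a<d. \<Sum>b<d. A $$ (a, b) * R $$ (a, b) - A $$ (a, b) * W $$ (a, b))"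
    using A W' R' by (simp add: frob_inner_sum[of _ d d] sum_subtractf)
  also have "\<dots> \<le> (\<Sum>a<d. \<Sum>b<d. (R $$ (a, b) * S $$ (a, b) - W $$ (a, b) * S $$ (a, b)) - lam * \<bar>R $$ (a, b)\<bar>
      + lam * \<bar>W $$ (a, b)\<bar> + (if a \<in> J \<and> b \<in> J then 5 / 4 * lam * D a b else 0))"
    by (intro sum_mono pt) auto
  also have "\<dots> = frob_inner R S - frob_inner W S - lam * entry_l1 R + lam * entry_l1 W
      + (\<Sum>a<d. \<Sum>b<d. (if a \<in> J \<and> b \<in> J then 5 / 4 * lam * D a b else 0))"
    using S W' R' by (simp add: frob_inner_sum[of _ d d] entry_l1_def sum_subtractf sum.distrib sum_distrib_left)
  also have "(\<Sum>a<d. \<Sum>b<d. (if a \<in> J \<and> b \<in> J then 5 / 4 * lam * D a b else 0))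
      = (\<Sum>a<d. if a \<in> J then (\<Sum>b<d. if b \<in> J then 5 / 4 * lam * D a b else 0) else 0)"
    by (intro sum.cong refl) auto
  also have "\<dots> = (\<Sum>a\<in>J. \<Sum>b\<in>J. 5 / 4 * lam * D a b)"
    using Jd by (simp add: sum.inter_restrict[symmetric] Int_absorb1)
  also have "\<dots> = 5 / 4 * lam * (\<Sum>z\<in>J \<times> J. D (fst z) (snd z))"
    by (simp add: sum.cartesian_product sum_distrib_left case_prod_beta)
  finally have basic: "\<rho> / 2 * F\<^sup>2 \<le> 5 / 4 * lam * (\<Sum>z\<in>J \<times> J. D (fst z) (snd z))" using opt by simp
  \<comment> \<open>Cauchy-Schwarz over the block, which has at most s^2 entries.\<close>
  have "(\<Sum>z\<in>J \<times> J. D (fst z) (snd z)) \<le> real s * F"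
  proof (rule power2_le_imp_le)
    have "(\<Sum>z\<in>J \<times> J. D (fst z) (snd z))\<^sup>2 \<le> (\<Sum>z\<in>J \<times> J. (D (fst z) (snd z))\<^sup>2) * card (J \<times> J)"
      by (rule sum_squared_le_sum_of_squares) 
    also have "(\<Sum>z\<in>J \<times> J. (D (fst z) (snd z))\<^sup>2) \<le> (\<Sum>z\<in>{..<d} \<times> {..<d}. (D (fst z) (snd z))\<^sup>2)"
      using Jd by (intro sum_mono2) auto
    also have "\<dots> = F\<^sup>2"
      using W'(1) R'(1) by (simp add: F_def frob_norm_def D_def sum_nonneg sum.cartesian_product case_prod_beta)
    also have "F\<^sup>2 * card (J \<times> J) \<le> F\<^sup>2 * (real s)\<^sup>2"
      using cJ by (intro mult_left_mono) (auto simp: card_cartesian_product power2_eq_square intro!: mult_mono)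
    finally show "(\<Sum>z\<in>J \<times> J. D (fst z) (snd z))\<^sup>2 \<le> (real s * F)\<^sup>2"
      by (simp add: power_mult_distrib mult.commute mult_right_mono)
  qed (simp add: F_def)
  then have "5 / 4 * lam * (\<Sum>z\<in>J \<times> J. D (fst z) (snd z)) \<le> 5 / 4 * lam * (real s * F)"
    using lam by (intro mult_left_mono) auto
  from order_trans[OF basic this] have main: "(\<rho> * F) * F \<le> (5 / 2 * lam * real s) * F"
    by (simp add: power2_eq_square algebra_simps)
  show ?thesis
  proof (cases "F = 0")
    case True then show ?thesis using lam by (simp add: F_def R_def)
  next
    case False
    then have "F > 0" by (simp add: F_def order_less_le)
    with main show ?thesis by (simp add: F_def R_def \<rho>_def)
  qed
qed

lemma eigenspace_error:
  assumes A: "A \<in> carrier_mat d d" "transpose_mat A = A" and S: "S \<in> carrier_mat d d"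
    and V: "top_eigvecs d k A V" and k: "1 \<le> k" "k < d" and s: "nonzero_rows V \<le> s"
    and gap: "0 < eig A k - eig A (k + 1)"
    and lam: "0 \<le> lam" and dev: "\<And>a b. a < d \<Longrightarrow> b < d \<Longrightarrow> \<bar>S $$ (a, b) - A $$ (a, b)\<bar> \<le> lam / 4"
    and W: "is_maximizer d k lam S W" and U: "top_eigvecs d k W U"
  shows "(INF Q \<in> orth_mats k. frob_norm (U - V * Q)) \<le> 4 * sqrt 2 / (eig A k - eig A (k + 1)) * real s * lam"
proof -
  define \<rho> where "\<rho> = eig A k - eig A (k + 1)"
  have V': "V \<in> carrier_mat d k" "transpose_mat V * V = 1\<^sub>m k" using V by (auto simp: top_eigvecs_def)
  have U': "U \<in> carrier_mat d k" "transpose_mat U * U = 1\<^sub>m k" using U by (auto simp: top_eigvecs_def)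
  have R: "V * transpose_mat V \<in> fantope d k" using projector_in_fantope[OF V'] k by simp
  have Wf: "W \<in> fantope d k" using W by (simp add: is_maximizer_def)
  obtain Q where Q: "Q \<in> orth_mats k"
    "frob_norm (U - V * Q) \<le> frob_norm (U * transpose_mat U - V * transpose_mat V)"
    using exists_orthogonal_alignment[OF V' U'] k by auto
  have "(INF Q \<in> orth_mats k. frob_norm (U - V * Q)) \<le> frob_norm (U - V * Q)"
    \<comment> \<open>The infimum in the reals needs a lower bound, here 0 by nonnegativity of the
      norm.\<close>
    by (rule cINF_lower[OF _ Q(1)]) (auto intro!: bdd_belowI[of _ 0])
  also note Q(2)
  also have "frob_norm (U * transpose_mat U - V * transpose_mat V) \<le> 2 * frob_norm (V * transpose_mat V - W)"
    by (rule projector_error_le[OF U k Wf R frob_inner_projector_self[OF V']])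
  also have "\<dots> \<le> 5 * lam * real s / \<rho>"
    using penalized_maximizer_error[OF A S V k s lam dev W] gap by (simp add: \<rho>_def field_simps)
  also have "\<dots> \<le> (4 * sqrt 2) * lam * real s / \<rho>"
  proof -
    have "5 \<le> 4 * sqrt 2" using real_le_rsqrt[of "5 / 4" 2] by (simp add: power2_eq_square)
    then show ?thesis using lam gap by (intro divide_right_mono mult_right_mono) (auto simp: \<rho>_def)
  qed
  finally show ?thesis by (simp add: \<rho>_def mult_ac)
qed

section \<open>Concentration of the truncated sample covariance\<close>

text \<open>For negative u = - v it suffices that (1 - v + v^2) exp v is at least 1, and exp v
  dominates its second order Taylor polynomial.\<close>

lemma exp_le_quadratic:
  fixes u :: real assumes "\<bar>u\<bar> \<le> 1" shows "exp u \<le> 1 + u + u\<^sup>2"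
proof (cases "0 \<le> u")
  case True then show ?thesis using exp_bound assms by simp
next
  case False
  define v where "v = - u"
  have v: "0 \<le> v" "v \<le> 1" using False assms by (auto simp: v_def)
  \<comment> \<open>The product in the next line expands to 1 plus exactly this expression.\<close>
  have "0 \<le> v\<^sup>2 / 2 + v ^ 3 / 2 + v ^ 4 / 2" using v by simp
  then have "1 \<le> (1 - v + v\<^sup>2) * (1 + v + v\<^sup>2 / 2)"
    by (simp add: field_simps power2_eq_square power3_eq_cube power4_eq_xxxx)
  also have "\<dots> \<le> (1 - v + v\<^sup>2) * exp v"
    using v exp_lower_Taylor_quadratic[of v] by (intro mult_left_mono) (auto simp: add_nonneg_nonneg)
  finally show ?thesis by (simp add: v_def exp_minus field_simps)
qed

text \<open>The sup bound \<open>T\<close> only keeps the exponent in the range of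
  \<open>exp_le_quadratic\<close>; the quadratic term carries the second moment bound
  \<open>B\<close>. This matters because \<open>T\<close> will be the squared truncation level,
  which grows with the sample size.\<close>

lemma (in prob_space) mgf_le:
  assumes Y: "Y \<in> borel_measurable M" and bd: "\<And>x. \<bar>Y x\<bar> \<le> (T::real)" and m2: "expectation (\<lambda>x. (Y x)\<^sup>2) \<le> B"
    and \<theta>: "0 \<le> \<theta>" "\<theta> * T \<le> 1"
  shows "expectation (\<lambda>x. exp (\<theta> * Y x)) \<le> exp (\<theta> * expectation Y + \<theta>\<^sup>2 * B)"
proof -
  have iY: "integrable M Y" by (rule integrable_const_bound[where B = T]) (use Y bd in auto)
  have "(Y x)\<^sup>2 \<le> T\<^sup>2" for x using bd[of x] by (metis abs_ge_zero abs_le_square_iff abs_of_nonneg order_trans)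
  then have iY2: "integrable M (\<lambda>x. (Y x)\<^sup>2)" by (intro integrable_const_bound[where B = "T\<^sup>2"]) (use Y in auto)
  have small: "\<bar>\<theta> * Y x\<bar> \<le> 1" for x
    using mult_left_mono[OF bd[of x] \<theta>(1)] \<theta> by (simp add: abs_mult)
  have iE: "integrable M (\<lambda>x. exp (\<theta> * Y x))"
    by (rule integrable_const_bound[where B = "exp 1"]) (use Y small in \<open>auto simp: abs_le_iff\<close>)
  have "expectation (\<lambda>x. exp (\<theta> * Y x)) \<le> expectation (\<lambda>x. 1 + \<theta> * Y x + \<theta>\<^sup>2 * (Y x)\<^sup>2)"
    using iE iY iY2 exp_le_quadratic[OF small] by (intro integral_mono) (auto simp: power_mult_distrib)
  also have "\<dots> = 1 + \<theta> * expectation Y + \<theta>\<^sup>2 * expectation (\<lambda>x. (Y x)\<^sup>2)"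
    using iY iY2 by (simp add: prob_space)
  also have "\<dots> \<le> 1 + (\<theta> * expectation Y + \<theta>\<^sup>2 * B)" using m2 by (simp add: mult_left_mono)
  also have "\<dots> \<le> exp (\<theta> * expectation Y + \<theta>\<^sup>2 * B)" by (rule exp_ge_add_one_self)
  finally show ?thesis .
qed

text \<open>Chernoff's bound: under the product measure the exponential moment of the sum is the
  n-th power of a single one. \<open>\<theta>\<close> stays free so that it can be matched to the
  truncation level.\<close>

lemma (in prob_space) sample_sum_upper_tail:
  fixes Y :: "'a \<Rightarrow> real" and T B \<theta> t :: real and n :: nat
  assumes Y: "Y \<in> borel_measurable M" and bd: "\<And>x. \<bar>Y x\<bar> \<le> (T::real)" and m2: "expectation (\<lambda>x. (Y x)\<^sup>2) \<le> B"
    and \<theta>: "0 < \<theta>" "\<theta> * T \<le> 1"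
  defines "P \<equiv> PiM {..<n} (\<lambda>_. M)"
  shows "measure P {\<omega> \<in> space P. (\<Sum>i<n. Y (\<omega> i)) \<ge> n * (expectation Y + t)} \<le> exp (n * (\<theta>\<^sup>2 * B - \<theta> * t))"
proof -
  interpret PP: product_prob_space "\<lambda>_. M" "{..<n}" by unfold_locales
  interpret P: prob_space P unfolding P_def by (intro prob_space_PiM prob_space_axioms)
  have small: "\<bar>\<theta> * Y x\<bar> \<le> 1" for x
  proof -
    have "\<theta> * \<bar>Y x\<bar> \<le> \<theta> * T" using bd \<theta> by (intro mult_left_mono) auto
    moreover have "\<bar>\<theta> * Y x\<bar> = \<theta> * \<bar>Y x\<bar>" using \<theta> by (simp add: abs_mult)
    ultimately show ?thesis using \<theta>(2) by linarith
  qed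
  have iE: "integrable M (\<lambda>x. exp (\<theta> * Y x))"
    by (rule integrable_const_bound[where B = "exp 1"]) (use Y small in \<open>auto simp: abs_le_iff\<close>)
  have prodE: "exp (\<theta> * (\<Sum>i<n. Y (\<omega> i))) = (\<Prod>i<n. exp (\<theta> * Y (\<omega> i)))" for \<omega>
    by (simp add: sum_distrib_left exp_sum)
  have iP: "integrable P (\<lambda>\<omega>. exp (\<theta> * (\<Sum>i<n. Y (\<omega> i))))"
    unfolding prodE P_def by (rule PP.product_integrable_prod) (use iE in auto)
  have "(\<integral>\<omega>. exp (\<theta> * (\<Sum>i<n. Y (\<omega> i))) \<partial>P) = (\<Prod>i<n. expectation (\<lambda>x. exp (\<theta> * Y x)))"
    unfolding prodE P_def by (rule PP.product_integral_prod) (use iE in auto)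
  also have "\<dots> = expectation (\<lambda>x. exp (\<theta> * Y x)) ^ n" by simp
  also have "\<dots> \<le> exp (\<theta> * expectation Y + \<theta>\<^sup>2 * B) ^ n"
    using mgf_le[OF Y bd m2 less_imp_le[OF \<theta>(1)] \<theta>(2)] by (intro power_mono integral_nonneg) auto
  also have "\<dots> = exp (n * (\<theta> * expectation Y + \<theta>\<^sup>2 * B))" by (simp add: exp_of_nat_mult)
  finally have mgf: "(\<integral>\<omega>. exp (\<theta> * (\<Sum>i<n. Y (\<omega> i))) \<partial>P) \<le> exp (n * (\<theta> * expectation Y + \<theta>\<^sup>2 * B))" .
  have "measure P {\<omega> \<in> space P. (\<Sum>i<n. Y (\<omega> i)) \<ge> n * (expectation Y + t)}
      \<le> exp (- \<theta> * (n * (expectation Y + t))) * (\<integral>\<omega>\<in>space P. exp (\<theta> * (\<Sum>i<n. Y (\<omega> i))) \<partial>P)"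
    by (rule P.Chernoff_ineq_ge[OF \<theta>(1)]) (use integrable_mult_indicator[OF sets.top iP] in \<open>auto simp: set_integrable_def\<close>)
  also have "(\<integral>\<omega>\<in>space P. exp (\<theta> * (\<Sum>i<n. Y (\<omega> i))) \<partial>P) = (\<integral>\<omega>. exp (\<theta> * (\<Sum>i<n. Y (\<omega> i))) \<partial>P)"
    by (rule set_integral_space[OF iP])
  also have "exp (- \<theta> * (n * (expectation Y + t))) * (\<integral>\<omega>. exp (\<theta> * (\<Sum>i<n. Y (\<omega> i))) \<partial>P)
      \<le> exp (- \<theta> * (n * (expectation Y + t))) * exp (n * (\<theta> * expectation Y + \<theta>\<^sup>2 * B))"
    using mgf by (intro mult_left_mono) auto
  also have "\<dots> = exp (n * (\<theta>\<^sup>2 * B - \<theta> * t))"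
    by (simp add: mult_exp_exp algebra_simps)
  finally show ?thesis .
qed

text \<open>The upper tail bound applied to \<open>Y\<close> and to \<open>- Y\<close>, whose sup
  and second moment bounds coincide.\<close>

lemma (in prob_space) sample_sum_tail:
  fixes Y :: "'a \<Rightarrow> real" and T B \<theta> t :: real and n :: nat
  assumes Y: "Y \<in> borel_measurable M" and bd: "\<And>x. \<bar>Y x\<bar> \<le> (T::real)" and m2: "expectation (\<lambda>x. (Y x)\<^sup>2) \<le> B"
    and \<theta>: "0 < \<theta>" "\<theta> * T \<le> 1"
  defines "P \<equiv> PiM {..<n} (\<lambda>_. M)"
  shows "measure P {\<omega> \<in> space P. \<bar>(\<Sum>i<n. Y (\<omega> i)) - n * expectation Y\<bar> \<ge> n * t} \<le> 2 * exp (n * (\<theta>\<^sup>2 * B - \<theta> * t))"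
proof -
  interpret PP: product_prob_space "\<lambda>_. M" "{..<n}" by unfold_locales
  interpret P: prob_space P unfolding P_def by (intro prob_space_PiM prob_space_axioms)
  have YP: "(\<lambda>\<omega>. Y (\<omega> i)) \<in> borel_measurable P" if "i < n" for i
    unfolding P_def using that by (intro measurable_compose[OF measurable_component_singleton[of i "{..<n}" "\<lambda>_. M"] Y]) auto
  have SP[measurable]: "(\<lambda>\<omega>. \<Sum>i<n. Y (\<omega> i)) \<in> borel_measurable P"
    using YP by (intro borel_measurable_sum) auto
  let ?A = "{\<omega> \<in> space P. (\<Sum>i<n. Y (\<omega> i)) \<ge> n * (expectation Y + t)}"
  let ?B = "{\<omega> \<in> space P. (\<Sum>i<n. - Y (\<omega> i)) \<ge> n * (expectation (\<lambda>x. - Y x) + t)}"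
  have A: "measure P ?A \<le> exp (n * (\<theta>\<^sup>2 * B - \<theta> * t))"
    unfolding P_def by (rule sample_sum_upper_tail[OF Y bd m2 \<theta>])
  have B: "measure P ?B \<le> exp (n * (\<theta>\<^sup>2 * B - \<theta> * t))"
    unfolding P_def by (rule sample_sum_upper_tail[OF _ _ _ \<theta>]) (use Y bd m2 in auto)
  have sets: "?A \<in> sets P" "?B \<in> sets P" by (simp_all add: sum_negf)
  have "{\<omega> \<in> space P. \<bar>(\<Sum>i<n. Y (\<omega> i)) - n * expectation Y\<bar> \<ge> n * t} \<subseteq> ?A \<union> ?B"
    by (auto simp: sum_negf algebra_simps abs_if split: if_splits)
  then have "measure P {\<omega> \<in> space P. \<bar>(\<Sum>i<n. Y (\<omega> i)) - n * expectation Y\<bar> \<ge> n * t} \<le> measure P (?A \<union> ?B)"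
    using sets by (intro P.finite_measure_mono) auto
  also have "\<dots> \<le> measure P ?A + measure P ?B" using sets by (intro measure_Un_le)
  finally show ?thesis using A B by simp
qed

section \<open>Truncation bias and entrywise deviation\<close>

lemma abs_trunc_le: "0 \<le> \<tau> \<Longrightarrow> \<bar>trunc \<tau> v j\<bar> \<le> \<tau>"
  by (auto simp: trunc_def abs_mult sgn_if)

lemma abs_trunc_le_abs: "0 \<le> \<tau> \<Longrightarrow> \<bar>trunc \<tau> v j\<bar> \<le> \<bar>v j\<bar>"
  by (auto simp: trunc_def abs_mult sgn_if)

lemma trunc_eq: "\<bar>v j\<bar> \<le> \<tau> \<Longrightarrow> trunc \<tau> v j = v j"
  by (auto simp: trunc_def sgn_if)

text \<open>Without truncation there is no error. Otherwise the larger absolute value m exceeds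
  \<open>\<tau>\<close>; truncation shrinks the product without flipping its sign, so the error is
  at most m^2, hence at most m^4 / \<open>\<tau>\<^sup>2\<close>. Either coordinate may be the large
  one, whence both fourth powers.\<close>

lemma trunc_product_bias:
  assumes \<tau>: "0 < \<tau>"
  shows "\<bar>trunc \<tau> v j * trunc \<tau> v l - v j * v l\<bar> \<le> (\<bar>v j\<bar> ^ 4 + \<bar>v l\<bar> ^ 4) / \<tau>\<^sup>2"
proof -
  define m where "m = max \<bar>v j\<bar> \<bar>v l\<bar>"
  have m4: "m ^ 4 \<le> \<bar>v j\<bar> ^ 4 + \<bar>v l\<bar> ^ 4" by (auto simp: m_def max_def)
  show ?thesis
  proof (cases "m \<le> \<tau>")
    case True
    then show ?thesis by (simp add: m_def trunc_eq)
  next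
    case False
    have t: "trunc \<tau> v i = sgn (v i) * min \<bar>v i\<bar> \<tau>" for i by (simp add: trunc_def)
    have "trunc \<tau> v j * trunc \<tau> v l - v j * v l = (sgn (v j) * sgn (v l)) * (min \<bar>v j\<bar> \<tau> * min \<bar>v l\<bar> \<tau> - \<bar>v j\<bar> * \<bar>v l\<bar>)"
      unfolding t by (simp add: sgn_if)
    then have "\<bar>trunc \<tau> v j * trunc \<tau> v l - v j * v l\<bar>
        = \<bar>sgn (v j) * sgn (v l)\<bar> * \<bar>min \<bar>v j\<bar> \<tau> * min \<bar>v l\<bar> \<tau> - \<bar>v j\<bar> * \<bar>v l\<bar>\<bar>"
      by (simp only: abs_mult)
    also have "\<dots> \<le> 1 * \<bar>min \<bar>v j\<bar> \<tau> * min \<bar>v l\<bar> \<tau> - \<bar>v j\<bar> * \<bar>v l\<bar>\<bar>"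
      by (intro mult_right_mono) (auto simp: sgn_if)
    also have "\<dots> = \<bar>min \<bar>v j\<bar> \<tau> * min \<bar>v l\<bar> \<tau> - \<bar>v j\<bar> * \<bar>v l\<bar>\<bar>" by simp
    also have "\<dots> \<le> \<bar>v j\<bar> * \<bar>v l\<bar>"
    proof -
      have "0 \<le> min \<bar>v j\<bar> \<tau> * min \<bar>v l\<bar> \<tau>" "min \<bar>v j\<bar> \<tau> * min \<bar>v l\<bar> \<tau> \<le> \<bar>v j\<bar> * \<bar>v l\<bar>"
        using \<tau> by (auto intro!: mult_mono)
      then show ?thesis by simp
    qed
    also have "\<dots> \<le> m * m" by (intro mult_mono) (auto simp: m_def)
    also have "\<dots> \<le> m ^ 4 / \<tau>\<^sup>2"
    proof -
      have "\<tau>\<^sup>2 \<le> m\<^sup>2" using False \<tau> by (intro power_mono) auto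
      then have "m * m * \<tau>\<^sup>2 \<le> m * m * m\<^sup>2" by (intro mult_left_mono) auto
      then show ?thesis using \<tau> by (simp add: field_simps power2_eq_square power4_eq_xxxx)
    qed
    also have "\<dots> \<le> (\<bar>v j\<bar> ^ 4 + \<bar>v l\<bar> ^ 4) / \<tau>\<^sup>2" using m4 by (intro divide_right_mono) auto
    finally show ?thesis .
  qed
qed

lemma borel_measurable_coordinate:
  assumes "sets \<mu> = sets (PiM {..<d} (\<lambda>_. borel))" and "j < d"
  shows "(\<lambda>x. x j) \<in> borel_measurable \<mu>"
  unfolding measurable_cong_sets[OF assms(1) refl]
  using assms(2) by (intro measurable_component_singleton) simp

lemma sample_cov_concentration:
  fixes \<mu> :: "(nat \<Rightarrow> real) measure" and Mb :: real and d n :: nat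
  assumes d: "2 \<le> d" and n: "1 \<le> n" and Mb: "0 < Mb"
    and \<mu>: "prob_space \<mu>" and sets_\<mu>: "sets \<mu> = sets (PiM {..<d} (\<lambda>_. borel))"
    and m4: "\<And>j. j < d \<Longrightarrow> (\<integral>\<^sup>+x. ennreal (\<bar>x j\<bar> ^ 4) \<partial>\<mu>) \<le> ennreal Mb"
    and m2: "\<And>j l. j < d \<Longrightarrow> l < d \<Longrightarrow> (\<integral>\<^sup>+x. ennreal (\<bar>x j * x l\<bar> ^ 2) \<partial>\<mu>) \<le> ennreal Mb"
  defines "\<epsilon> \<equiv> sqrt (Mb * ln (real d) / real n)"
    and "\<tau> \<equiv> (Mb * real n / ln (real d)) powr (1 / 4)"
    and "P \<equiv> PiM {..<n} (\<lambda>_. \<mu>)"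
  shows "\<exists>E \<in> sets P. measure P E \<ge> 1 - 1 / (real d)\<^sup>2 \<and>
    (\<forall>\<omega>\<in>E. \<forall>j<d. \<forall>l<d. \<bar>trunc_sample_cov d n \<tau> \<omega> $$ (j, l) - cov_mat d \<mu> $$ (j, l)\<bar> \<le> 8 * \<epsilon>)"
proof -
  interpret prob_space \<mu> by (rule \<mu>)
  interpret P: prob_space P unfolding P_def by (intro prob_space_PiM \<mu>)
  define L where "L = ln (real d)"
  have L: "L > 0" using d by (simp add: L_def)
  have n0: "real n > 0" using n by simp
  have \<epsilon>: "\<epsilon> > 0" using Mb L n0 by (simp add: \<epsilon>_def L_def)
  have \<epsilon>2: "\<epsilon>\<^sup>2 = Mb * L / n" using Mb L n0 by (simp add: \<epsilon>_def L_def)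
  have \<tau>: "\<tau> > 0" using Mb L n0 by (simp add: \<tau>_def L_def)
  have "\<tau>\<^sup>2 = (Mb * real n / L) powr (1 / 2)"
    unfolding \<tau>_def L_def by (simp flip: powr_realpow[OF \<tau>[unfolded \<tau>_def]] add: powr_powr)
  also have "\<dots> = sqrt (Mb * real n / L)" using Mb L n0 by (simp add: powr_half_sqrt)
  finally have \<tau>2: "\<tau>\<^sup>2 = sqrt (Mb * real n / L)" .
  \<comment> \<open>The balance behind the choice of \<open>\<tau>\<close>: it makes the bias 2
    \<open>Mb\<close> / \<open>\<tau>\<^sup>2\<close> equal to 2 \<open>\<epsilon>\<close>, and it
    makes \<open>\<theta> * Mb\<close> equal to \<open>\<epsilon>\<close> in the tail bound.\<close>
  have \<tau>\<epsilon>: "\<tau>\<^sup>2 * \<epsilon> = Mb"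
    unfolding \<tau>2 \<epsilon>_def L_def[symmetric] using Mb L n0 by (simp add: real_sqrt_mult[symmetric])
  note meas = borel_measurable_coordinate[OF sets_\<mu>]
  define Y where "Y j l x = trunc \<tau> x j * trunc \<tau> x l" for j l and x :: "nat \<Rightarrow> real"
  have Ymeas: "Y j l \<in> borel_measurable \<mu>" if "j < d" "l < d" for j l
    unfolding Y_def trunc_def using meas[OF that(1)] meas[OF that(2)] by measurable
  have Ybd: "\<bar>Y j l x\<bar> \<le> \<tau>\<^sup>2" for j l x
    unfolding Y_def abs_mult power2_eq_square using \<tau> by (intro mult_mono abs_trunc_le) auto
  \<comment> \<open>A moment bound on the nonnegative integral contains finiteness, so integrability
    follows from it and the bound passes to the Bochner integral.\<close>
  have int4: "integrable \<mu> (\<lambda>x. \<bar>x j\<bar> ^ 4)" and le4: "expectation (\<lambda>x. \<bar>x j\<bar> ^ 4) \<le> Mb" if j: "j < d" for j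
  proof -
    show i: "integrable \<mu> (\<lambda>x. \<bar>x j\<bar> ^ 4)"
      by (rule integrableI_bounded) (use meas[OF j] m4[OF j] in \<open>auto simp: power_abs intro: le_less_trans[OF _ ennreal_less_top]\<close>)
    have "ennreal (expectation (\<lambda>x. \<bar>x j\<bar> ^ 4)) \<le> ennreal Mb"
      using m4[OF j] by (subst nn_integral_eq_integral[symmetric, OF i]) auto
    then show "expectation (\<lambda>x. \<bar>x j\<bar> ^ 4) \<le> Mb" using Mb by simp
  qed
  have int2: "integrable \<mu> (\<lambda>x. \<bar>x j * x l\<bar> ^ 2)" and le2: "expectation (\<lambda>x. \<bar>x j * x l\<bar> ^ 2) \<le> Mb"
    if jl: "j < d" "l < d" for j l
  proof -
    show i: "integrable \<mu> (\<lambda>x. \<bar>x j * x l\<bar> ^ 2)"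
      by (rule integrableI_bounded) (use meas[OF jl(1)] meas[OF jl(2)] m2[OF jl] in \<open>auto intro: le_less_trans[OF _ ennreal_less_top]\<close>)
    have "ennreal (expectation (\<lambda>x. \<bar>x j * x l\<bar> ^ 2)) \<le> ennreal Mb"
      using m2[OF jl] by (subst nn_integral_eq_integral[symmetric, OF i]) auto
    then show "expectation (\<lambda>x. \<bar>x j * x l\<bar> ^ 2) \<le> Mb" using Mb by simp
  qed
  \<comment> \<open>Truncation only shrinks absolute values, so the second moment of the product
    stays below \<open>Mb\<close> whatever \<open>\<tau>\<close> is.\<close>
  have Y2: "expectation (\<lambda>x. (Y j l x)\<^sup>2) \<le> Mb" if jl: "j < d" "l < d" for j l
  proof -
    have "(Y j l x)\<^sup>2 \<le> \<bar>x j * x l\<bar> ^ 2" for x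
    proof -
      have "\<bar>Y j l x\<bar> \<le> \<bar>x j * x l\<bar>"
        unfolding Y_def abs_mult using \<tau> by (intro mult_mono abs_trunc_le_abs) auto
      then show ?thesis by (simp add: abs_le_square_iff)
    qed
    then have "expectation (\<lambda>x. (Y j l x)\<^sup>2) \<le> expectation (\<lambda>x. \<bar>x j * x l\<bar> ^ 2)"
      using int2[OF jl] by (intro integral_mono') auto
    then show ?thesis using le2[OF jl] by simp
  qed
  have bias: "\<bar>expectation (Y j l) - cov_mat d \<mu> $$ (j, l)\<bar> \<le> 2 * \<epsilon>" if jl: "j < d" "l < d" for j l
  proof -
    have iY: "integrable \<mu> (Y j l)"
      by (rule integrable_const_bound[where B = "\<tau>\<^sup>2"]) (use Ybd Ymeas[OF jl] in auto)
    \<comment> \<open>Gives integrability of \<open>x j * x l\<close> from that of its square, on a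
      probability space.\<close>
    have sq: "\<bar>a\<bar> \<le> 1 + \<bar>a\<bar> ^ 2" for a :: real
    proof -
      have "2 * \<bar>a\<bar> \<le> 1 + \<bar>a\<bar> ^ 2"
        using zero_le_power2[of "\<bar>a\<bar> - 1"] by (simp add: power2_diff)
      then show ?thesis using abs_ge_zero[of a] by linarith
    qed
    have iX: "integrable \<mu> (\<lambda>x. x j * x l)"
    proof (rule Bochner_Integration.integrable_bound)
      show "integrable \<mu> (\<lambda>x. 1 + \<bar>x j * x l\<bar> ^ 2)"
        by (intro Bochner_Integration.integrable_add integrable_const int2[OF jl])
      show "(\<lambda>x. x j * x l) \<in> borel_measurable \<mu>"
        by (intro borel_measurable_times meas jl)
      show "AE x in \<mu>. norm (x j * x l) \<le> norm (1 + \<bar>x j * x l\<bar> ^ 2)"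
        unfolding real_norm_def by (rule AE_I2) (rule order_trans[OF sq abs_ge_self])
    qed
    have "\<bar>expectation (Y j l) - expectation (\<lambda>x. x j * x l)\<bar> = \<bar>expectation (\<lambda>x. Y j l x - x j * x l)\<bar>"
      using iY iX by simp
    also have "\<dots> \<le> expectation (\<lambda>x. \<bar>Y j l x - x j * x l\<bar>)" by (rule integral_abs_bound)
    also have "\<dots> \<le> expectation (\<lambda>x. (\<bar>x j\<bar> ^ 4 + \<bar>x l\<bar> ^ 4) / \<tau>\<^sup>2)"
    proof (rule integral_mono)
      show "integrable \<mu> (\<lambda>x. \<bar>Y j l x - x j * x l\<bar>)"
        by (intro integrable_abs Bochner_Integration.integrable_diff iY iX)
      show "integrable \<mu> (\<lambda>x. (\<bar>x j\<bar> ^ 4 + \<bar>x l\<bar> ^ 4) / \<tau>\<^sup>2)"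
        by (intro integrable_divide Bochner_Integration.integrable_add int4 jl)
    qed (unfold Y_def, rule trunc_product_bias[OF \<tau>])
    also have "\<dots> = (expectation (\<lambda>x. \<bar>x j\<bar> ^ 4) + expectation (\<lambda>x. \<bar>x l\<bar> ^ 4)) / \<tau>\<^sup>2"
      using int4 jl by simp
    also have "\<dots> \<le> (Mb + Mb) / \<tau>\<^sup>2" using le4 jl by (intro divide_right_mono add_mono) auto
    also have "\<dots> = 2 * \<epsilon>" using \<tau>\<epsilon> \<tau> by (simp add: field_simps)
    finally show ?thesis using jl by (simp add: cov_mat_def)
  qed
  \<comment> \<open>The Chernoff parameter \<open>\<theta> = 1 / \<tau>\<^sup>2\<close> makes \<open>n \<theta>\<^sup>2 Mb = n \<theta> \<epsilon> = L\<close>.\<close>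
  define \<theta> where "\<theta> = 1 / \<tau>\<^sup>2"
  have \<theta>: "\<theta> > 0" "\<theta> * \<tau>\<^sup>2 \<le> 1" using \<tau> by (simp_all add: \<theta>_def)
  have \<theta>Mb: "\<theta> * Mb = \<epsilon>" using \<tau>\<epsilon> \<tau> by (simp add: \<theta>_def field_simps)
  have n\<theta>\<epsilon>: "n * (\<theta> * \<epsilon>) = L"
  proof -
    have "Mb * (n * (\<theta> * \<epsilon>)) = n * ((\<theta> * Mb) * \<epsilon>)" by (simp only: mult_ac)
    also have "\<dots> = n * \<epsilon>\<^sup>2" unfolding \<theta>Mb by (simp add: power2_eq_square)
    also have "\<dots> = Mb * L" unfolding \<epsilon>2 using n0 by simp
    finally show ?thesis using Mb by simp
  qed
  \<comment> \<open>The threshold 6 \<open>\<epsilon>\<close> gives the exponent L - 6 L = - 5 L,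
    that is, the power d^(-5).\<close>
  define B where "B j l = {\<omega> \<in> space P. \<bar>(\<Sum>i<n. Y j l (\<omega> i)) - n * expectation (Y j l)\<bar> \<ge> n * (6 * \<epsilon>)}" for j l
  have YP: "(\<lambda>\<omega>. Y j l (\<omega> i)) \<in> borel_measurable P" if "i < n" "j < d" "l < d" for i j l
    unfolding P_def using that
    by (intro measurable_compose[OF measurable_component_singleton[of i "{..<n}" "\<lambda>_. \<mu>"] Ymeas]) auto
  have SP: "(\<lambda>\<omega>. \<Sum>i<n. Y j l (\<omega> i)) \<in> borel_measurable P" if "j < d" "l < d" for j l
    using YP that by (intro borel_measurable_sum) auto
  have Bsets: "B j l \<in> sets P" if "j < d" "l < d" for j l
    unfolding B_def using SP[OF that] by measurable
  have Bm: "measure P (B j l) \<le> 2 / real d ^ 5" if jl: "j < d" "l < d" for j l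
  proof -
    have "measure P (B j l) \<le> 2 * exp (n * (\<theta>\<^sup>2 * Mb - \<theta> * (6 * \<epsilon>)))"
      unfolding B_def P_def by (rule sample_sum_tail[OF Ymeas[OF jl] Ybd Y2[OF jl] \<theta>])
    also have "n * (\<theta>\<^sup>2 * Mb - \<theta> * (6 * \<epsilon>)) = n * (\<theta> * (\<theta> * Mb)) - 6 * (n * (\<theta> * \<epsilon>))"
      by (simp add: power2_eq_square algebra_simps)
    also have "\<dots> = - (real 5 * L)" unfolding \<theta>Mb n\<theta>\<epsilon> by simp
    also have "exp (- (real 5 * L)) = 1 / real d ^ 5"
      using d by (simp only: exp_minus exp_of_nat_mult) (simp add: L_def inverse_eq_divide)
    finally show ?thesis by simp
  qed
  define Bad where "Bad = (\<Union>z\<in>{..<d} \<times> {..<d}. B (fst z) (snd z))"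
  have Bad: "Bad \<in> sets P" unfolding Bad_def using Bsets by (intro sets.finite_UN) auto
  have "measure P Bad \<le> (\<Sum>z\<in>{..<d} \<times> {..<d}. measure P (B (fst z) (snd z)))"
    unfolding Bad_def using Bsets by (intro P.finite_measure_subadditive_finite) auto
  also have "\<dots> \<le> (\<Sum>z\<in>{..<d} \<times> {..<d}. 2 / real d ^ 5)" using Bm by (intro sum_mono) auto
  \<comment> \<open>There are d^2 pairs, so the union bound leaves 2 d^(-3); one factor 2 / d is at
    most 1 because d is at least 2.\<close>
  also have "\<dots> = (2 / real d) * (1 / (real d)\<^sup>2)" using d by (simp add: power2_eq_square field_simps eval_nat_numeral)
  also have "\<dots> \<le> 1 * (1 / (real d)\<^sup>2)" using d by (intro mult_right_mono) auto
  finally have mBad: "measure P Bad \<le> 1 / (real d)\<^sup>2" by simp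
  have "\<bar>trunc_sample_cov d n \<tau> \<omega> $$ (j, l) - cov_mat d \<mu> $$ (j, l)\<bar> \<le> 8 * \<epsilon>"
    if \<omega>: "\<omega> \<in> space P - Bad" and jl: "j < d" "l < d" for \<omega> j l
  proof -
    have "\<omega> \<notin> B j l" using \<omega> jl by (auto simp: Bad_def)
    then have "\<bar>(\<Sum>i<n. Y j l (\<omega> i)) - n * expectation (Y j l)\<bar> \<le> (6 * \<epsilon>) * n"
      using \<omega> by (simp add: B_def mult_ac not_le)
    then have "\<bar>(\<Sum>i<n. Y j l (\<omega> i)) - n * expectation (Y j l)\<bar> / n \<le> 6 * \<epsilon>"
      unfolding pos_divide_le_eq[OF n0] .
    moreover have "trunc_sample_cov d n \<tau> \<omega> $$ (j, l) = (\<Sum>i<n. Y j l (\<omega> i)) / n"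
      using jl by (simp add: trunc_sample_cov_def Y_def)
    moreover have "\<bar>(\<Sum>i<n. Y j l (\<omega> i)) / n - expectation (Y j l)\<bar>
        = \<bar>(\<Sum>i<n. Y j l (\<omega> i)) - n * expectation (Y j l)\<bar> / n"
      using n0 by (simp add: diff_divide_distrib[symmetric] abs_divide field_simps)
    ultimately have "\<bar>trunc_sample_cov d n \<tau> \<omega> $$ (j, l) - expectation (Y j l)\<bar> \<le> 6 * \<epsilon>"
      by simp
    then show ?thesis using bias[OF jl] by linarith
  qed
  moreover have "measure P (space P - Bad) \<ge> 1 - 1 / (real d)\<^sup>2"
    using P.prob_compl[OF Bad] mBad by simp
  moreover have "space P - Bad \<in> sets P" using Bad by auto
  ultimately show ?thesis by blast
qed

section \<open>The degenerate moment bound and the final assembly\<close>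

lemma cov_mat_carrier [simp]: "cov_mat d \<mu> \<in> carrier_mat d d"
  by (simp add: cov_mat_def)

lemma cov_mat_sym: "transpose_mat (cov_mat d \<mu>) = cov_mat d \<mu>"
  by (intro eq_matI) (auto simp: cov_mat_def mult.commute)

lemma trunc_sample_cov_carrier [simp]: "trunc_sample_cov d n \<tau> \<omega> \<in> carrier_mat d d"
  by (simp add: trunc_sample_cov_def)

lemma eig_zero_mat:
  assumes "1 \<le> i" "i \<le> d" shows "eig (0\<^sub>m d d) i = 0"
proof -
  have on: "orthonormal d d (unit_vec d)" by (auto simp: orthonormal_def)
  have "proots (char_poly (0\<^sub>m d d :: real mat)) = mset (map (\<lambda>_. 0) [0..<d])"
    by (rule proots_char_poly_eigenbasis[OF _ on]) auto
  then have "mset (eigvals_desc (0\<^sub>m d d)) = mset (map (\<lambda>_. 0) [0..<d])" by (simp add: eigvals_desc_def)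
  then have "set (eigvals_desc (0\<^sub>m d d)) = set (map (\<lambda>_. 0) [0..<d])" by (rule mset_eq_setD)
  then have "set (eigvals_desc (0\<^sub>m d d)) \<subseteq> {0}" by auto
  moreover have "length (eigvals_desc (0\<^sub>m d d)) = d" by (rule length_eigvals_desc) auto
  moreover have "eigvals_desc (0\<^sub>m d d) ! (i - 1) \<in> set (eigvals_desc (0\<^sub>m d d))"
    using assms calculation(2) by (intro nth_mem) simp
  ultimately show ?thesis by (auto simp: eig_def)
qed

text \<open>\<open>ennreal\<close> sends a nonpositive \<open>Mb\<close> to 0, so all products
  \<open>x j * x l\<close> vanish almost everywhere. A zero covariance has no eigengap, which is how
  positivity of \<open>Mb\<close> is obtained in the theorem.\<close>

lemma cov_mat_eq_zero:
  assumes sets_\<mu>: "sets \<mu> = sets (PiM {..<d} (\<lambda>_. borel))" and Mb: "Mb \<le> 0"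
    and m2: "\<And>j l. j < d \<Longrightarrow> l < d \<Longrightarrow> (\<integral>\<^sup>+x. ennreal (\<bar>x j * x l\<bar> ^ 2) \<partial>\<mu>) \<le> ennreal Mb"
  shows "cov_mat d \<mu> = 0\<^sub>m d d"
proof (rule eq_matI)
  fix j l assume "j < dim_row (0\<^sub>m d d :: real mat)" "l < dim_col (0\<^sub>m d d :: real mat)"
  then have jl: "j < d" "l < d" by auto
  note meas = borel_measurable_coordinate[OF sets_\<mu>]
  have "(\<integral>\<^sup>+x. ennreal (\<bar>x j * x l\<bar> ^ 2) \<partial>\<mu>) = 0" using m2[OF jl] Mb by (simp add: ennreal_neg)
  then have "AE x in \<mu>. ennreal (\<bar>x j * x l\<bar> ^ 2) = 0"
    using meas[OF jl(1)] meas[OF jl(2)] by (subst (asm) nn_integral_0_iff_AE) auto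
  then have "AE x in \<mu>. x j * x l = 0" by eventually_elim (auto simp: ennreal_eq_0_iff)
  then have "(\<integral>x. x j * x l \<partial>\<mu>) = 0" by (rule integral_eq_zero_AE)
  then show "cov_mat d \<mu> $$ (j, l) = 0\<^sub>m d d $$ (j, l)" using jl by (simp add: cov_mat_def)
qed (auto simp: cov_mat_def)

theorem mainTheorem9:
  "\<exists>C1 C2 :: real. C1 > 0 \<and> C2 > 0 \<and>
   (\<forall>(d::nat) (k::nat) (n::nat) (s::nat) (Mb::real) (\<mu>::(nat \<Rightarrow> real) measure) (Vstar::real mat).
      2 \<le> d \<longrightarrow> 1 \<le> k \<longrightarrow> k < d \<longrightarrow> 1 \<le> n \<longrightarrow>
      prob_space \<mu> \<longrightarrow> sets \<mu> = sets (PiM {..<d} (\<lambda>_. borel)) \<longrightarrow>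
      (\<forall>j<d. (\<integral>x. x j \<partial>\<mu>) = 0) \<longrightarrow>
      (\<forall>j<d. (\<integral>\<^sup>+x. ennreal (\<bar>x j\<bar> ^ 4) \<partial>\<mu>) \<le> ennreal Mb) \<longrightarrow>
      (\<forall>j<d. \<forall>l<d. (\<integral>\<^sup>+x. ennreal (\<bar>x j * x l\<bar> ^ 2) \<partial>\<mu>) \<le> ennreal Mb) \<longrightarrow>
      eig (cov_mat d \<mu>) k - eig (cov_mat d \<mu>) (k + 1) > 0 \<longrightarrow>
      top_eigvecs d k (cov_mat d \<mu>) Vstar \<longrightarrow>
      nonzero_rows Vstar \<le> s \<longrightarrow>
      (let lam = C1 * sqrt (Mb * ln (real d) / real n);
           \<tau> = (C2 * Mb * real n / ln (real d)) powr (1 / 4);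
           \<rho>0 = eig (cov_mat d \<mu>) k - eig (cov_mat d \<mu>) (k + 1);
           P = PiM {..<n} (\<lambda>_. \<mu>)
       in \<exists>E \<in> sets P. measure P E \<ge> 1 - 1 / (real d)\<^sup>2 \<and>
            (\<forall>\<omega> \<in> E. \<forall>W V.
               is_maximizer d k lam (trunc_sample_cov d n \<tau> \<omega>) W \<longrightarrow>
               top_eigvecs d k W V \<longrightarrow>
               (INF Q \<in> orth_mats k. frob_norm (V - Vstar * Q))
                 \<le> 4 * sqrt 2 / \<rho>0 * real s * lam)))"
\<comment> \<open>The deviation 8 eps, made of fluctuation 6 eps and bias 2 eps, has to be a quarter
  of the penalty level, so C1 = 4 * 8.\<close>
proof (rule exI[of _ 32], rule exI[of _ 1], intro conjI allI impI)
  fix d k n s :: nat and Mb :: real and \<mu> :: "(nat \<Rightarrow> real) measure" and Vstar :: "real mat"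
  assume d: "2 \<le> d" and k: "1 \<le> k" "k < d" and n: "1 \<le> n"
    and \<mu>: "prob_space \<mu>" "sets \<mu> = sets (PiM {..<d} (\<lambda>_. borel))"
    and m4: "\<forall>j<d. (\<integral>\<^sup>+x. ennreal (\<bar>x j\<bar> ^ 4) \<partial>\<mu>) \<le> ennreal Mb"
    and m2: "\<forall>j<d. \<forall>l<d. (\<integral>\<^sup>+x. ennreal (\<bar>x j * x l\<bar> ^ 2) \<partial>\<mu>) \<le> ennreal Mb"
    and gap: "eig (cov_mat d \<mu>) k - eig (cov_mat d \<mu>) (k + 1) > 0"
    and V: "top_eigvecs d k (cov_mat d \<mu>) Vstar" and s: "nonzero_rows Vstar \<le> s"
  have Mb: "Mb > 0"
  proof (rule ccontr)
    assume "\<not> Mb > 0"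
    then have "cov_mat d \<mu> = 0\<^sub>m d d" using cov_mat_eq_zero[OF \<mu>(2), of Mb] m2 by simp
    then show False using gap k by (simp add: eig_zero_mat)
  qed
  define \<tau> where "\<tau> = (Mb * real n / ln (real d)) powr (1 / 4)"
  define \<epsilon> where "\<epsilon> = sqrt (Mb * ln (real d) / real n)"
  define P where "P = PiM {..<n} (\<lambda>_. \<mu>)"
  obtain E where E: "E \<in> sets P" "measure P E \<ge> 1 - 1 / (real d)\<^sup>2"
    and dev: "\<And>\<omega> j l. \<omega> \<in> E \<Longrightarrow> j < d \<Longrightarrow> l < d \<Longrightarrow>
      \<bar>trunc_sample_cov d n \<tau> \<omega> $$ (j, l) - cov_mat d \<mu> $$ (j, l)\<bar> \<le> 8 * \<epsilon>"
    using sample_cov_concentration[OF d n Mb \<mu> m4[rule_format] m2[rule_format]]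
    unfolding \<tau>_def[symmetric] \<epsilon>_def[symmetric] P_def[symmetric] by blast
  have \<epsilon>: "0 \<le> 32 * \<epsilon>" using Mb d by (simp add: \<epsilon>_def)
  have bound: "(INF Q \<in> orth_mats k. frob_norm (V - Vstar * Q))
      \<le> 4 * sqrt 2 / (eig (cov_mat d \<mu>) k - eig (cov_mat d \<mu>) (k + 1)) * real s * (32 * \<epsilon>)"
    if "\<omega> \<in> E" "is_maximizer d k (32 * \<epsilon>) (trunc_sample_cov d n \<tau> \<omega>) W" "top_eigvecs d k W V" for \<omega> W V
    by (rule eigenspace_error[OF cov_mat_carrier cov_mat_sym trunc_sample_cov_carrier V k s gap \<epsilon> _ that(2,3)])
      (use dev[OF that(1)] in simp)
  show "let lam = 32 * sqrt (Mb * ln (real d) / real n);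
           \<tau> = (1 * Mb * real n / ln (real d)) powr (1 / 4);
           \<rho>0 = eig (cov_mat d \<mu>) k - eig (cov_mat d \<mu>) (k + 1);
           P = PiM {..<n} (\<lambda>_. \<mu>)
       in \<exists>E \<in> sets P. measure P E \<ge> 1 - 1 / (real d)\<^sup>2 \<and>
            (\<forall>\<omega> \<in> E. \<forall>W V.
               is_maximizer d k lam (trunc_sample_cov d n \<tau> \<omega>) W \<longrightarrow>
               top_eigvecs d k W V \<longrightarrow>
               (INF Q \<in> orth_mats k. frob_norm (V - Vstar * Q))
                 \<le> 4 * sqrt 2 / \<rho>0 * real s * lam)"
    unfolding Let_def mult_1 \<tau>_def[symmetric] \<epsilon>_def[symmetric] P_def[symmetric]
    by (intro bexI[OF _ E(1)] conjI ballI allI impI E(2) bound)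
qed simp_all

end
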